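(* Let $(L,\mathfrak{a},P,\triangle)$ and $(L,\mathfrak{a},P,\triangle')$ be two compatible $V$-datas over a field of characteristic $0$, with corresponding $L_\infty$-algebras $(s\mathfrak{a},\{l_k\}_{k\ge1})$ and $(s\mathfrak{a},\{l'_k\}_{k\ge1})$. Then $(s\mathfrak{a},\{l_k\}_{k\ge1},\{l'_k\}_{k\ge1})$ is a compatible $L_\infty$-algebra.
   Context: A $V$-data $(L,\mathfrak{a},P,\triangle)$ consists of a graded Lie algebra $(L,[~,~])$, an abelian graded Lie subalgebra $\mathfrak{a}\subset L$, a (degree $0$ linear) projection $P:L\to L$ with image $\mathfrak{a}$ and whose kernel is a graded Lie subalgebra of $L$, and an element $\triangle\in\ker(P)_1$ with $[\triangle,\triangle]=0$. It induces degree $1$ graded symmetric maps on $\mathfrak{a}$, $\rho_k(a_1,\dots,a_k)=P[\cdots[[\triangle,a_1],a_2],\dots,a_k]$, $k\ge1$, and an $L_\infty$-algebra $(s\mathfrak{a},\{l_k\}_{k\ge1})$ (a theorem of Voronov), called the corresponding $L_\infty$-algebra, where $s\mathfrak{a}$ is the suspension, $(s\mathfrak{a})_i=\mathfrak{a}_{i-1}$, and $l_k=s\circ\rho_k\circ(s^{-1})^{\otimes k}$ (with Koszul signs). Two $V$-datas $(L,\mathfrak{a},P,\triangle)$ and $(L,\mathfrak{a},P,\triangle')$ (same $L,\mathfrak{a},P$) are compatible if $[\triangle,\triangle']=0$. For $\sigma\in S_n$, $\chi(\sigma)=(-1)^\sigma\epsilon(\sigma)$ with $\epsilon(\sigma)$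 the Koszul sign; $Sh(i,n-i)$ is the set of $(i,n-i)$-shuffles ($\sigma(1)<\cdots<\sigma(i)$, $\sigma(i+1)<\cdots<\sigma(n)$). An $L_\infty$-algebra is a graded vector space with graded skew-symmetric multilinear maps $l_k$ of degree $2-k$, $k\ge1$, such that for all $n\ge1$, $$\sum_{i+j=n+1}\sum_{\sigma\in Sh(i,n-i)}\chi(\sigma)(-1)^{i(j-1)}\,l_j\big(l_i(x_{\sigma(1)},\dots,x_{\sigma(i)}),x_{\sigma(i+1)},\dots,x_{\sigma(n)}\big)=0.$$ A compatible $L_\infty$-algebra is a triple with two $L_\infty$-structures $\{l_k\},\{l'_k\}$ on the same graded vector space such that for all $n\ge1$, $$\sum_{i+j=n+1}\sum_{\sigma\in Sh(i,n-i)}\chi(\sigma)(-1)^{i(j-1)}\Big\{l_j\big(l'_i(x_{\sigma(1)},\dots,x_{\sigma(i)}),x_{\sigma(i+1)},\dots,x_{\sigma(n)}\big)+l'_j\big(l_i(x_{\sigma(1)},\dots,x_{\sigma(i)}),x_{\sigma(i+1)},\dots,x_{\sigma(n)}\big)\Big\}=0.$$ *)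

theory Defs
  imports Complex_Main "HOL-Combinatorics.Permutations"
begin

section \<open>Graded vector spaces\<close>

text \<open>A graded vector space is given by its homogeneous parts \<open>V i\<close>, which are subspaces
  of an ambient vector space whose sum is direct.  The space itself is \<open>graded_total scale V\<close>.\<close>

definition graded_space :: "('k::field \<Rightarrow> 'v::ab_group_add \<Rightarrow> 'v) \<Rightarrow> (int \<Rightarrow> 'v set) \<Rightarrow> bool" where
  "graded_space scale V \<longleftrightarrow> (\<forall>i. module.subspace scale (V i)) \<and>
     (\<forall>c. (\<forall>i. c i \<in> V i) \<and> finite {i. c i \<noteq> 0} \<and> (\<Sum>i | c i \<noteq> 0. c i) = 0
          \<longrightarrow> (\<forall>i. c i = 0))"

definition graded_total :: "('k::field \<Rightarrow> 'v::ab_group_add \<Rightarrow> 'v) \<Rightarrow> (int \<Rightarrow> 'v set) \<Rightarrow> 'v set" where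
  "graded_total scale V = module.span scale (\<Union>i. V i)"

definition components :: "(int \<Rightarrow> 'v::ab_group_add set) \<Rightarrow> 'v \<Rightarrow> int \<Rightarrow> 'v" where
  "components V x =
     (THE c. (\<forall>i. c i \<in> V i) \<and> finite {i. c i \<noteq> 0} \<and> x = (\<Sum>i | c i \<noteq> 0. c i))"

text \<open>The linear map multiplying a homogeneous \<open>x\<close> by \<open>(-1)^(m |x|)\<close>.\<close>

definition degree_twist ::
    "('k::field \<Rightarrow> 'v::ab_group_add \<Rightarrow> 'v) \<Rightarrow> (int \<Rightarrow> 'v set) \<Rightarrow> nat \<Rightarrow> 'v \<Rightarrow> 'v" where
  "degree_twist scale V m x =
     (\<Sum>i | components V x i \<noteq> 0. scale ((-1) powi (int m * i)) (components V x i))"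

text \<open>A map of \<open>k\<close> arguments is a function on lists of length \<open>k\<close>; its values on other
  lists are irrelevant.\<close>

definition multilinear_on ::
    "('k::field \<Rightarrow> 'v::ab_group_add \<Rightarrow> 'v) \<Rightarrow> 'v set \<Rightarrow> nat \<Rightarrow> ('v list \<Rightarrow> 'v) \<Rightarrow> bool" where
  "multilinear_on scale T k f \<longleftrightarrow>
     (\<forall>xs ys u v c. set xs \<subseteq> T \<and> set ys \<subseteq> T \<and> u \<in> T \<and> v \<in> T
          \<and> length xs + 1 + length ys = k \<longrightarrow>
        f (xs @ (u + v) # ys) = f (xs @ u # ys) + f (xs @ v # ys) \<and>
        f (xs @ scale c u # ys) = scale c (f (xs @ u # ys)))"

text \<open>The suspension \<open>s\<close> and its inverse are the identity on underlying vectors; only the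
  degrees change.\<close>

definition suspension :: "(int \<Rightarrow> 'v set) \<Rightarrow> int \<Rightarrow> 'v set" where
  "suspension V i = V (i - 1)"


section \<open>Signs and shuffles\<close>

text \<open>Positions are numbered from \<open>0\<close>, so \<open>S_n\<close> acts on \<open>{..<n}\<close>.  The function \<open>d\<close> gives the
  degrees \<open>d p = |x p|\<close>.  The Koszul sign is the sign in
  \<open>x 0 \<odot> \<dots> \<odot> x (n-1) = \<epsilon>(\<sigma>) x (\<sigma> 0) \<odot> \<dots> \<odot> x (\<sigma> (n-1))\<close>: each inversion
  of \<open>\<sigma>\<close> contributes the sign of interchanging the two elements involved.\<close>

definition koszul_sign :: "nat \<Rightarrow> (nat \<Rightarrow> int) \<Rightarrow> (nat \<Rightarrow> nat) \<Rightarrow> 'k::field" where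
  "koszul_sign n d \<sigma> =
     (\<Prod>(p, q) \<in> {(p, q). p < q \<and> q < n \<and> \<sigma> q < \<sigma> p}. (-1) powi (d (\<sigma> p) * d (\<sigma> q)))"

definition chi :: "nat \<Rightarrow> (nat \<Rightarrow> int) \<Rightarrow> (nat \<Rightarrow> nat) \<Rightarrow> 'k::field" where
  "chi n d \<sigma> = of_int (sign \<sigma>) * koszul_sign n d \<sigma>"

definition shuffle_perms :: "nat \<Rightarrow> nat \<Rightarrow> (nat \<Rightarrow> nat) set" where
  "shuffle_perms i n =
     {\<sigma>. \<sigma> permutes {..<n} \<and> strict_mono_on {..<i} \<sigma> \<and> strict_mono_on {i..<n} \<sigma>}"


section \<open>$L_\infty$-algebras\<close>

text \<open>\<open>nested l l' n x \<sigma> i j\<close> is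
  \<open>l_j (l'_i (x (\<sigma> 0), \<dots>, x (\<sigma> (i-1))), x (\<sigma> i), \<dots>, x (\<sigma> (n-1)))\<close>.\<close>

definition nested :: "(nat \<Rightarrow> 'v list \<Rightarrow> 'v) \<Rightarrow> (nat \<Rightarrow> 'v list \<Rightarrow> 'v) \<Rightarrow>
    nat \<Rightarrow> (nat \<Rightarrow> 'v) \<Rightarrow> (nat \<Rightarrow> nat) \<Rightarrow> nat \<Rightarrow> nat \<Rightarrow> 'v" where
  "nested l l' n x \<sigma> i j =
     l j (l' i (map (\<lambda>p. x (\<sigma> p)) [0..<i]) # map (\<lambda>p. x (\<sigma> p)) [i..<n])"

definition jacobi_sum ::
    "('k::field \<Rightarrow> 'v::ab_group_add \<Rightarrow> 'v) \<Rightarrow>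
     nat \<Rightarrow> (nat \<Rightarrow> int) \<Rightarrow> ((nat \<Rightarrow> nat) \<Rightarrow> nat \<Rightarrow> nat \<Rightarrow> 'v) \<Rightarrow> 'v" where
  "jacobi_sum scale n d F =
     (\<Sum>(i, j) \<in> {(i, j). 1 \<le> i \<and> 1 \<le> j \<and> i + j = n + 1}.
        \<Sum>\<sigma> \<in> shuffle_perms i n. scale (chi n d \<sigma> * (-1) ^ (i * (j - 1))) (F \<sigma> i j))"

locale L_infinity_algebra = vector_space scale
  for scale :: "'k::field_char_0 \<Rightarrow> 'v::ab_group_add \<Rightarrow> 'v" (infixr \<open>*s\<close> 75) +
  fixes V :: "int \<Rightarrow> 'v set"
    and l :: "nat \<Rightarrow> 'v list \<Rightarrow> 'v"
  assumes graded: "graded_space scale V"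
    and multilinear: "1 \<le> k \<Longrightarrow> multilinear_on scale (graded_total scale V) k (l k)"
    and degree: "1 \<le> k \<Longrightarrow> (\<And>p. p < k \<Longrightarrow> x p \<in> V (d p)) \<Longrightarrow>
          l k (map x [0..<k]) \<in> V ((\<Sum>p<k. d p) + 2 - int k)"
    and skew: "1 \<le> k \<Longrightarrow> (\<And>p. p < k \<Longrightarrow> x p \<in> V (d p)) \<Longrightarrow> \<sigma> permutes {..<k} \<Longrightarrow>
          l k (map (\<lambda>p. x (\<sigma> p)) [0..<k]) = chi k d \<sigma> *s l k (map x [0..<k])"
    and jacobi: "1 \<le> n \<Longrightarrow> (\<And>p. p < n \<Longrightarrow> x p \<in> V (d p)) \<Longrightarrow>
          jacobi_sum scale n d (nested l l n x) = 0"

locale compatible_L_infinity_algebra =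
  L_infinity_algebra scale V l + prime: L_infinity_algebra scale V l'
  for scale :: "'k::field_char_0 \<Rightarrow> 'v::ab_group_add \<Rightarrow> 'v" (infixr \<open>*s\<close> 75)
    and V l l' +
  assumes compatible: "1 \<le> n \<Longrightarrow> (\<And>p. p < n \<Longrightarrow> x p \<in> V (d p)) \<Longrightarrow>
      jacobi_sum scale n d (\<lambda>\<sigma> i j. nested l l' n x \<sigma> i j + nested l' l n x \<sigma> i j) = 0"


section \<open>Graded Lie algebras and V-data\<close>

text \<open>The graded Lie algebra occupies the whole type \<open>'v\<close>.\<close>

locale graded_lie_algebra = vector_space scale
  for scale :: "'k::field_char_0 \<Rightarrow> 'v::ab_group_add \<Rightarrow> 'v" (infixr \<open>*s\<close> 75) +
  fixes L :: "int \<Rightarrow> 'v set"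
    and br :: "'v \<Rightarrow> 'v \<Rightarrow> 'v"
  assumes graded: "graded_space scale L"
    and total: "graded_total scale L = UNIV"
    and linear_right: "Vector_Spaces.linear scale scale (\<lambda>y. br x y)"
    and linear_left: "Vector_Spaces.linear scale scale (\<lambda>x. br x y)"
    and degree: "x \<in> L i \<Longrightarrow> y \<in> L j \<Longrightarrow> br x y \<in> L (i + j)"
    and antisym: "x \<in> L i \<Longrightarrow> y \<in> L j \<Longrightarrow> br x y = - (((-1) powi (i * j)) *s br y x)"
    and jacobi: "x \<in> L i \<Longrightarrow> y \<in> L j \<Longrightarrow> z \<in> L k \<Longrightarrow>
          br x (br y z) = br (br x y) z + ((-1) powi (i * j)) *s br y (br x z)"
begin

text \<open>The first condition says that \<open>H\<close> is a subspace spanned by its homogeneous elements.\<close>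

definition graded_lie_subalgebra :: "'v set \<Rightarrow> bool" where
  "graded_lie_subalgebra H \<longleftrightarrow>
     H = graded_total scale (\<lambda>i. H \<inter> L i) \<and> (\<forall>x\<in>H. \<forall>y\<in>H. br x y \<in> H)"

end

locale V_data = graded_lie_algebra scale L br
  for scale :: "'k::field_char_0 \<Rightarrow> 'v::ab_group_add \<Rightarrow> 'v" (infixr \<open>*s\<close> 75)
    and L br +
  fixes \<aa> :: "'v set"
    and P :: "'v \<Rightarrow> 'v"
    and \<Delta> :: 'v
  assumes subalgebra: "graded_lie_subalgebra \<aa>"
    and abelian: "x \<in> \<aa> \<Longrightarrow> y \<in> \<aa> \<Longrightarrow> br x y = 0"
    and P_linear: "Vector_Spaces.linear scale scale P"
    and P_degree: "x \<in> L i \<Longrightarrow> P x \<in> L i"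
    and P_proj: "P (P x) = P x"
    and P_image: "range P = \<aa>"
    and P_kernel: "graded_lie_subalgebra {x. P x = 0}"
    and Delta_degree: "\<Delta> \<in> L 1"
    and Delta_kernel: "P \<Delta> = 0"
    and Delta_square: "br \<Delta> \<Delta> = 0"

locale compatible_V_data =
  V_data scale L br \<aa> P \<Delta> + prime: V_data scale L br \<aa> P \<Delta>'
  for scale :: "'k::field_char_0 \<Rightarrow> 'v::ab_group_add \<Rightarrow> 'v" (infixr \<open>*s\<close> 75)
    and L br \<aa> P \<Delta> \<Delta>' +
  assumes compatible: "br \<Delta> \<Delta>' = 0"

text \<open>The space \<open>s\<aa>\<close>, with \<open>\<aa>\<close> graded by \<open>\<aa> \<inter> L i\<close>.\<close>

definition suspended :: "(int \<Rightarrow> 'v set) \<Rightarrow> 'v set \<Rightarrow> int \<Rightarrow> 'v set" where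
  "suspended L \<aa> = suspension (\<lambda>i. \<aa> \<inter> L i)"

text \<open>\<open>rho br P \<Delta> [a\<^sub>1, \<dots>, a\<^sub>k] = P [\<dots>[[\<Delta>, a\<^sub>1], a\<^sub>2], \<dots>, a\<^sub>k]\<close>.\<close>

definition rho :: "('v \<Rightarrow> 'v \<Rightarrow> 'v) \<Rightarrow> ('v \<Rightarrow> 'v) \<Rightarrow> 'v \<Rightarrow> 'v list \<Rightarrow> 'v" where
  "rho br P \<Delta> as = P (foldl br \<Delta> as)"

text \<open>\<open>l_k = s \<circ> \<rho>_k \<circ> (s^-1)^{\<otimes>k}\<close>.  By the Koszul rule
  \<open>(s^-1)^{\<otimes>k} (x\<^sub>0, \<dots>, x_{k-1})\<close> carries the sign \<open>(-1)^{\<Sum>p. (k-1-p) |x_p|}\<close>, since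
  \<open>x_p\<close> is passed by the \<open>k-1-p\<close> later copies of the odd map \<open>s^-1\<close>; here \<open>|x_p|\<close> is the
  degree in \<open>s\<aa>\<close>.  The twist in each argument extends this sign linearly to
  inhomogeneous elements.\<close>

definition derived_bracket ::
    "('k::field \<Rightarrow> 'v::ab_group_add \<Rightarrow> 'v) \<Rightarrow>
     (int \<Rightarrow> 'v set) \<Rightarrow> ('v \<Rightarrow> 'v \<Rightarrow> 'v) \<Rightarrow> 'v set \<Rightarrow> ('v \<Rightarrow> 'v) \<Rightarrow> 'v \<Rightarrow> nat \<Rightarrow> 'v list \<Rightarrow> 'v" where
  "derived_bracket scale L br \<aa> P \<Delta> k xs =
     rho br P \<Delta> (map (\<lambda>p. degree_twist scale (suspended L \<aa>) (k - 1 - p) (xs ! p)) [0..<k])"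

end

theory Submission
  imports Defs
begin

text \<open>For a set \<open>S\<close> of positions let \<open>D_S = [\<dots>[\<Delta>, x_p], \<dots>]\<close> be the bracket of \<open>\<Delta>\<close> with the \<open>x_p\<close>,
  \<open>p \<in> S\<close>, in increasing order.  Since bracketing is a derivation,
  \<open>0 = [\<dots>[[\<Delta>, \<Delta>'], x_0], \<dots>, x_{n-1}] = \<Sum>S. \<plusminus>[D_S, D'_{S^c}]\<close>.
  As \<open>ker P\<close> is a subalgebra and \<open>\<aa>\<close> is abelian, \<open>P[u, v] = P[P u, v] + P[u, P v]\<close>; and
  \<open>P D_S \<in> \<aa>\<close> can be moved past the \<open>x_p\<close>, so applying \<open>P\<close> turns the sum into
  \<open>\<Sum>S. \<epsilon>(S) (\<rho>'(\<rho>(x_S), x_{S^c}) + \<rho>(\<rho>'(x_S), x_{S^c})) = 0\<close>.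
  Shuffles correspond to subsets, and the signs of the suspension turn \<open>\<epsilon>\<close> into \<open>\<chi>\<close>.
  The case \<open>\<Delta>' = \<Delta>\<close> is twice the Jacobi identity of \<open>{l_k}\<close>, whence Voronov's theorem in
  characteristic \<open>0\<close>.\<close>

section \<open>Permutations and their inversions\<close>

lemma minus_one_powi: "(-1 :: 'a::field) powi m = (if even m then 1 else -1)"
  by (auto simp: power_int_def minus_one_power_iff even_nat_iff)

lemma minus_one_powi_cong:
  assumes "a = b + 2 * c"
  shows "(-1 :: 'a::field) powi a = (-1) powi b"
  using assms by (simp add: minus_one_powi)

lemma minus_one_powi_sum: "(-1 :: 'a::field) powi (\<Sum>x\<in>A. f x) = (\<Prod>x\<in>A. (-1) powi f x)"
  by (induction A rule: infinite_finite_induct) (simp_all add: power_int_add)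

text \<open>The index set of the product in \<open>koszul_sign\<close>. Its cardinality is also the
  measure for induction on permutations.\<close>

definition inversions :: "nat \<Rightarrow> (nat \<Rightarrow> nat) \<Rightarrow> (nat \<times> nat) set" where
  "inversions n \<sigma> = {(p, q). p < q \<and> q < n \<and> \<sigma> q < \<sigma> p}"

lemma finite_inversions [simp]: "finite (inversions n \<sigma>)"
  by (rule finite_subset[of _ "{..<n} \<times> {..<n}"]) (auto simp: inversions_def)

text \<open>No natural number lies strictly between \<open>i\<close> and \<open>Suc i\<close>, so
  exchanging them disturbs only their own comparison.\<close>

lemma transpose_Suc_less:
  assumes "p < q" "(p, q) \<noteq> (i, Suc i)"
  shows "transpose i (Suc i) p < transpose i (Suc i) q"
  using assms by (auto simp: transpose_def)

text \<open>Relabelling positions by the swap matches old inversions with new ones, and the former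
  ascent at \<open>i\<close> becomes one extra inversion. The three facts together allow products
  and cardinalities over the new set to be computed.\<close>

lemma inversions_comp_transpose:
  assumes "Suc i < n" "\<sigma> i < \<sigma> (Suc i)"
  defines "t \<equiv> transpose i (Suc i)"
  shows "inversions n (\<sigma> \<circ> t) = insert (i, Suc i) (map_prod t t ` inversions n \<sigma>)" (is ?eq)
    and "(i, Suc i) \<notin> map_prod t t ` inversions n \<sigma>" (is ?notin)
    and "inj_on (map_prod t t) A"
proof -
  have tt: "t (t p) = p" for p by (simp add: t_def)
  have tn: "t p < n" if "p < n" for p using that assms(1) by (auto simp: t_def transpose_def)
  show ?notin
  proof
    assume "(i, Suc i) \<in> map_prod t t ` inversions n \<sigma>"
    then obtain p q where "(p, q) \<in> inversions n \<sigma>" "t p = i" "t q = Suc i" by auto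
    moreover from this have "p = Suc i" "q = i"
      by (metis tt t_def transpose_apply_first, metis tt t_def transpose_apply_second)
    ultimately show False by (auto simp: inversions_def)
  qed
  show "inj_on (map_prod t t) A"
    by (rule inj_on_subset[OF prod.inj_map]) (auto simp: t_def)
  show ?eq
  proof (intro equalityI subsetI)
    fix z assume "z \<in> inversions n (\<sigma> \<circ> t)"
    then obtain p q where z: "z = (p, q)" "p < q" "q < n" "\<sigma> (t q) < \<sigma> (t p)"
      by (auto simp: inversions_def)
    show "z \<in> insert (i, Suc i) (map_prod t t ` inversions n \<sigma>)"
    proof (cases "z = (i, Suc i)")
      case False
      then have "(t p, t q) \<in> inversions n \<sigma>"
        using z transpose_Suc_less[of p q i] tn by (auto simp: inversions_def t_def)
      then have "map_prod t t (t p, t q) \<in> map_prod t t ` inversions n \<sigma>" by (rule imageI)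
      then show ?thesis using z by (simp add: tt)
    qed simp
  next
    fix z assume "z \<in> insert (i, Suc i) (map_prod t t ` inversions n \<sigma>)"
    then consider "z = (i, Suc i)" | p q where "z = (t p, t q)" "(p, q) \<in> inversions n \<sigma>" by auto
    then show "z \<in> inversions n (\<sigma> \<circ> t)"
    proof cases
      case 1
      then show ?thesis using assms by (auto simp: inversions_def)
    next
      case 2
      then have "(p, q) \<noteq> (i, Suc i)" using assms(2) by (auto simp: inversions_def)
      then have "t p < t q"
        using 2 transpose_Suc_less[of p q i] by (auto simp: inversions_def t_def)
      then show ?thesis using 2 tn by (auto simp: inversions_def tt)
    qed
  qed
qed

text \<open>Both lists are sorted and distinct with the same set of entries.\<close>

lemma strict_mono_on_eq_filter:
  assumes "strict_mono_on {i..<k} \<sigma>" "\<sigma> ` {i..<k} \<subseteq> {..<n}"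
  shows "map \<sigma> [i..<k] = filter (\<lambda>p. p \<in> \<sigma> ` {i..<k}) [0..<n]"
proof (rule sorted_distinct_set_unique)
  show "sorted (map \<sigma> [i..<k])"
    using assms(1)
    by (auto simp: sorted_iff_nth_mono_less intro!: less_imp_le strict_mono_onD[OF assms(1)])
  show "distinct (map \<sigma> [i..<k])"
    using strict_mono_on_imp_inj_on[OF assms(1)] by (simp add: distinct_map)
qed (use assms in \<open>auto simp: sorted_wrt_filter\<close>)

lemma permutes_strict_mono_imp_id:
  fixes n :: nat
  assumes "\<sigma> permutes {..<n}" "strict_mono_on {..<n} \<sigma>"
  shows "\<sigma> = id"
proof -
  have "\<sigma> ` {0..<n} = {..<n}"
    using permutes_image[OF assms(1)] by (simp add: atLeast0LessThan)
  then have "map \<sigma> [0..<n] = filter (\<lambda>p. p \<in> {..<n}) [0..<n]"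
    using strict_mono_on_eq_filter[of 0 n \<sigma> n] assms(2) by (simp add: atLeast0LessThan)
  also have "\<dots> = map id [0..<n]" by (simp add: filter_id_conv)
  finally have "\<sigma> p = p" if "p < n" for p
    using that by (metis atLeast0LessThan id_apply lessThan_iff map_eq_conv set_upt)
  then show ?thesis using permutes_not_in[OF assms(1)] by (metis ext id_apply lessThan_iff)
qed

text \<open>Bubble sort: undoing a descent lowers the number of inversions, and a permutation
  without descents is the identity. The step is restricted to ascents, where the change of a sign is
  a single new factor.\<close>

lemma adjacent_transposition_induct [consumes 1, case_names id step]:
  assumes "\<sigma> permutes {..<n}"
    and id: "Q id"
    and step: "\<And>\<sigma> i. \<sigma> permutes {..<n} \<Longrightarrow> Suc i < n \<Longrightarrow> \<sigma> i < \<sigma> (Suc i) \<Longrightarrow> Q \<sigma> \<Longrightarrow>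
                 Q (\<sigma> \<circ> transpose i (Suc i))"
  shows "Q \<sigma>"
  using assms(1)
proof (induction "card (inversions n \<sigma>)" arbitrary: \<sigma> rule: less_induct)
  case less
  show ?case
  proof (cases "\<exists>i. Suc i < n \<and> \<sigma> (Suc i) < \<sigma> i")
    case True
    then obtain i where i: "Suc i < n" "\<sigma> (Suc i) < \<sigma> i" by blast
    \<comment> \<open>The swap turns the descent of \<open>\<sigma>\<close> at \<open>i\<close> into
      an ascent of \<open>\<tau>\<close>, and a second swap recovers
      \<open>\<sigma>\<close>.\<close>
    define \<tau> where "\<tau> = \<sigma> \<circ> transpose i (Suc i)"
    have \<sigma>: "\<sigma> = \<tau> \<circ> transpose i (Suc i)" by (simp add: \<tau>_def comp_assoc)
    have \<tau>: "\<tau> permutes {..<n}"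
      unfolding \<tau>_def using i less.prems by (intro permutes_compose permutes_swap_id) auto
    have lt: "\<tau> i < \<tau> (Suc i)" using i by (simp add: \<tau>_def)
    have "card (inversions n \<tau>) < card (inversions n \<sigma>)"
      unfolding \<sigma> using inversions_comp_transpose[OF i(1) lt] by (simp add: card_image)
    then have "Q \<tau>" using less.hyps \<tau> by blast
    then show ?thesis unfolding \<sigma> using step \<tau> i(1) lt by blast
  next
    case False
    have "\<sigma> i < \<sigma> (Suc i)" if "Suc i < n" for i
    proof -
      have "\<sigma> i \<noteq> \<sigma> (Suc i)"
        using permutes_inj[OF less.prems] by (metis inj_eq n_not_Suc_n)
      then show ?thesis using False that by (meson linorder_neqE_nat)
    qed
    then have "\<sigma> p < \<sigma> q" if "p < q" "q < n" for p q
      using that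
    proof (induction q)
      case (Suc q)
      then show ?case by (metis Suc_lessD less_SucE less_trans)
    qed simp
    then have "strict_mono_on {..<n} \<sigma>" by (auto simp: strict_mono_on_def)
    then show ?thesis using permutes_strict_mono_imp_id less.prems id by blast
  qed
qed

section \<open>Koszul and decalage signs under adjacent transpositions\<close>

lemma koszul_sign_inversions:
  "koszul_sign n d \<sigma> = (\<Prod>(p, q)\<in>inversions n \<sigma>. (-1) powi (d (\<sigma> p) * d (\<sigma> q)))"
  by (simp add: koszul_sign_def inversions_def)

lemma koszul_sign_id [simp]: "koszul_sign n d id = 1"
  by (auto simp: koszul_sign_def intro!: prod.neutral)

text \<open>The new inversion supplies the extra factor; the other factors are only
  reindexed.\<close>

lemma koszul_sign_comp_transpose:
  assumes "Suc i < n" "\<sigma> i < \<sigma> (Suc i)"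
  shows "koszul_sign n d (\<sigma> \<circ> transpose i (Suc i)) =
           (-1) powi (d (\<sigma> i) * d (\<sigma> (Suc i))) * koszul_sign n d \<sigma>"
  unfolding koszul_sign_inversions inversions_comp_transpose(1)[OF assms]
  by (subst prod.insert)
     (simp_all add: inversions_comp_transpose(2)[OF assms] prod.reindex
        inversions_comp_transpose(3)[OF assms] case_prod_unfold mult.commute)

lemma chi_id [simp]: "chi n d id = 1"
  by (simp add: chi_def)

lemma chi_comp_transpose:
  assumes "\<sigma> permutes {..<n}" "Suc i < n" "\<sigma> i < \<sigma> (Suc i)"
  shows "chi n d (\<sigma> \<circ> transpose i (Suc i)) =
           - ((-1) powi (d (\<sigma> i) * d (\<sigma> (Suc i))) * chi n d \<sigma>)"
proof -
  have "permutation \<sigma>" using assms(1) permutation_permutes by blast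
  then have "sign (\<sigma> \<circ> transpose i (Suc i)) = - sign \<sigma>"
    by (simp add: sign_compose permutation_swap_id sign_swap_id)
  then show ?thesis by (simp add: chi_def koszul_sign_comp_transpose[OF assms(2,3)])
qed

text \<open>Exponent of the Koszul sign of \<open>(s^-1)^{\<otimes>n}\<close>.\<close>

definition decalage :: "nat \<Rightarrow> (nat \<Rightarrow> int) \<Rightarrow> int" where
  "decalage n d = (\<Sum>p<n. int (n - 1 - p) * d p)"

text \<open>The weights \<open>n - 1 - p\<close> of neighbouring positions differ by one, so the
  exchange leaves just the difference of the two degrees.\<close>

lemma decalage_comp_transpose:
  assumes "Suc i < n"
  shows "decalage n (d \<circ> transpose i (Suc i)) = decalage n d + d (Suc i) - d i"
proof -
  define t where "t = transpose i (Suc i)"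
  have t: "t permutes {..<n}" unfolding t_def using assms by (intro permutes_swap_id) auto
  \<comment> \<open>Reindexing by \<open>t\<close> moves the permutation from the degrees to the
    weights, which change only at \<open>i\<close> and \<open>Suc i\<close>.\<close>
  have "decalage n (d \<circ> t) = (\<Sum>p<n. int (n - 1 - t p) * d (t (t p)))"
    unfolding decalage_def using sum.permute[OF t, of "\<lambda>p. int (n - 1 - p) * (d \<circ> t) p"]
    by (simp add: comp_def)
  also have "\<dots> = (\<Sum>p<n. int (n - 1 - p) * d p +
                    (if p = Suc i then d p else 0) - (if p = i then d p else 0))"
    using assms by (intro sum.cong) (auto simp: t_def transpose_def algebra_simps of_nat_diff)
  also have "\<dots> = decalage n d + d (Suc i) - d i"
    using assms by (simp add: decalage_def sum.distrib sum_subtractf)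
  finally show ?thesis by (simp add: t_def)
qed

text \<open>The decalage correspondence: skew signs for the degrees \<open>d p\<close> on
  \<open>s\<aa>\<close> become symmetric signs for the degrees \<open>d p - 1\<close> on
  \<open>\<aa>\<close>. An adjacent swap of degrees \<open>a\<close>, \<open>b\<close> changes both
  sides equally, since \<open>(a - 1) * (b - 1)\<close> and \<open>a * b + (b - a) + 1\<close> have
  the same parity.\<close>

lemma chi_decalage:
  assumes "\<sigma> permutes {..<n}"
  shows "chi n d \<sigma> * (-1) powi decalage n (d \<circ> \<sigma>) =
           (-1 :: 'k::field) powi decalage n d * koszul_sign n (\<lambda>p. d p - 1) \<sigma>"
  using assms
proof (induction rule: adjacent_transposition_induct)
  case id
  show ?case by (simp only: comp_id chi_id koszul_sign_id mult_1 mult_1_right)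
next
  case (step \<sigma> i)
  let ?a = "d (\<sigma> i)" and ?b = "d (\<sigma> (Suc i))"
  have dec: "decalage n (d \<circ> (\<sigma> \<circ> transpose i (Suc i))) = decalage n (d \<circ> \<sigma>) + (?b - ?a)"
    using decalage_comp_transpose[OF step(2), of "d \<circ> \<sigma>"] by (simp add: comp_assoc)
  have "chi n d (\<sigma> \<circ> transpose i (Suc i)) *
          (-1 :: 'k) powi decalage n (d \<circ> (\<sigma> \<circ> transpose i (Suc i))) =
        - ((-1) powi (?a * ?b) * (-1) powi (?b - ?a)) * (chi n d \<sigma> * (-1) powi decalage n (d \<circ> \<sigma>))"
    unfolding dec chi_comp_transpose[OF step(1-3)] by (subst power_int_add) simp_all
  also have "- ((-1) powi (?a * ?b) * (-1) powi (?b - ?a)) = (-1 :: 'k) powi ((?a - 1) * (?b - 1))"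
    by (auto simp: minus_one_powi)
  finally show ?case
    unfolding koszul_sign_comp_transpose[OF step(2,3)] step.IH by (simp only: ac_simps)
qed


section \<open>Shuffles and subsets\<close>

text \<open>Only positions below \<open>n\<close> are listed, so \<open>-S\<close> can stand for the
  complement of \<open>S\<close> in \<open>{..<n}\<close>.\<close>

abbreviation pick :: "nat \<Rightarrow> nat set \<Rightarrow> nat list" where
  "pick n S \<equiv> filter (\<lambda>p. p \<in> S) [0..<n]"

text \<open>Exponent of the Koszul sign of moving the elements at positions in \<open>S\<close> to the front.\<close>

definition crossing :: "nat \<Rightarrow> (nat \<Rightarrow> int) \<Rightarrow> nat set \<Rightarrow> int" where
  "crossing n e S = (\<Sum>q | q < n \<and> q \<in> S. \<Sum>p | p < q \<and> p \<notin> S. e q * e p)"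

lemma Collect_less_Suc_conj:
  "{q. q < Suc n \<and> Q q} = (if Q n then insert n {q. q < n \<and> Q q} else {q. q < n \<and> Q q})"
  by (auto simp: less_Suc_eq)

lemma crossing_0 [simp]: "crossing 0 e S = 0"
  by (simp add: crossing_def)

text \<open>The last position, if chosen, passes every unchosen earlier one; if not chosen, nothing
  has to pass it.\<close>

lemma crossing_Suc:
  "crossing (Suc n) e S =
     crossing n e S + (if n \<in> S then e n * (\<Sum>p | p < n \<and> p \<notin> S. e p) else 0)"
  by (simp add: crossing_def Collect_less_Suc_conj sum_distrib_left)

text \<open>Each pair of a chosen and an unchosen position is counted once, by \<open>S\<close> or
  by \<open>-S\<close> according to which of the two comes first.\<close>

lemma crossing_compl:
  "crossing n e S + crossing n e (-S) = (\<Sum>p | p < n \<and> p \<in> S. e p) * (\<Sum>p | p < n \<and> p \<notin> S. e p)"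
  by (induction n) (simp_all add: crossing_Suc Collect_less_Suc_conj algebra_simps)

lemma shuffle_perms_image:
  assumes "\<sigma> \<in> shuffle_perms i n" "i \<le> n"
  shows "\<sigma> ` {i..<n} = {..<n} - \<sigma> ` {..<i}" "\<sigma> ` {..<i} \<subseteq> {..<n}" "card (\<sigma> ` {..<i}) = i"
proof -
  have \<sigma>: "\<sigma> permutes {..<n}" using assms(1) by (simp add: shuffle_perms_def)
  have "{i..<n} = {..<n} - {..<i}" by auto
  then show "\<sigma> ` {i..<n} = {..<n} - \<sigma> ` {..<i}"
    using image_set_diff[OF permutes_inj[OF \<sigma>]] permutes_image[OF \<sigma>] by metis
  show "\<sigma> ` {..<i} \<subseteq> {..<n}"
    using permutes_image[OF \<sigma>] assms(2) by (metis image_mono lessThan_subset_iff)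
  show "card (\<sigma> ` {..<i}) = i"
    by (simp add: card_image permutes_inj_on[OF \<sigma>])
qed

lemma shuffle_perms_pick:
  assumes "\<sigma> \<in> shuffle_perms i n" "i \<le> n"
  shows "map \<sigma> [0..<i] = pick n (\<sigma> ` {..<i})" "map \<sigma> [i..<n] = pick n (- \<sigma> ` {..<i})"
proof -
  show "map \<sigma> [0..<i] = pick n (\<sigma> ` {..<i})"
    using assms shuffle_perms_image(2)[OF assms]
    by (subst strict_mono_on_eq_filter[of _ _ _ n])
       (auto simp: shuffle_perms_def atLeast0LessThan)
  show "map \<sigma> [i..<n] = pick n (- \<sigma> ` {..<i})"
    using assms shuffle_perms_image(1)[OF assms]
    by (subst strict_mono_on_eq_filter[of _ _ _ n])
       (auto simp: shuffle_perms_def intro!: filter_cong)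
qed

text \<open>A shuffle is recovered from the image of its first block, because each block lists its
  values in increasing order.\<close>

lemma bij_betw_shuffle_perms:
  assumes "i \<le> n"
  shows "bij_betw (\<lambda>\<sigma>. \<sigma> ` {..<i}) (shuffle_perms i n) {S. S \<subseteq> {..<n} \<and> card S = i}"
proof (intro bij_betw_imageI)
  show "inj_on (\<lambda>\<sigma>. \<sigma> ` {..<i}) (shuffle_perms i n)"
  proof (rule inj_onI)
    fix \<sigma> \<tau>
    assume *: "\<sigma> \<in> shuffle_perms i n" "\<tau> \<in> shuffle_perms i n" "\<sigma> ` {..<i} = \<tau> ` {..<i}"
    have "map \<sigma> ([0..<i] @ [i..<n]) = map \<tau> ([0..<i] @ [i..<n])"
      using shuffle_perms_pick[OF *(1) assms] shuffle_perms_pick[OF *(2) assms] *(3) by simp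
    moreover have "[0..<i] @ [i..<n] = [0..<n]" using assms by (metis le_add_diff_inverse less_eq_nat.simps(1) plus_nat.add_0 upt_add_eq_append)
    ultimately have "\<sigma> p = \<tau> p" if "p < n" for p using that by simp
    moreover have "\<sigma> p = \<tau> p" if "\<not> p < n" for p
      using * that by (auto simp: shuffle_perms_def permutes_def)
    ultimately show "\<sigma> = \<tau>" by blast
  qed
  show "(\<lambda>\<sigma>. \<sigma> ` {..<i}) ` shuffle_perms i n = {S. S \<subseteq> {..<n} \<and> card S = i}"
  proof (intro equalityI subsetI)
    fix S assume "S \<in> {S. S \<subseteq> {..<n} \<and> card S = i}"
    then have S: "S \<subseteq> {..<n}" "card S = i" by auto
    \<comment> \<open>One-line notation of the shuffle belonging to \<open>S\<close>: first
      \<open>S\<close>, then its complement, both increasing.\<close>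
    define xs where "xs = pick n S @ pick n (-S)"
    define \<sigma> where "\<sigma> p = (if p < n then xs ! p else p)" for p
    have set_S: "set (pick n S) = S" using S by auto
    have len_S: "length (pick n S) = i"
      using distinct_card[of "pick n S"] S set_S by simp
    have set_xs: "set xs = {..<n}" and dist: "distinct xs" using S by (auto simp: xs_def)
    have len: "length xs = n" using distinct_card[OF dist] set_xs by simp
    have "bij_betw (\<lambda>p. xs ! p) {..<n} {..<n}"
      using bij_betw_nth[OF dist, of "{..<n}"] set_xs len by simp
    then have "bij_betw \<sigma> {..<n} {..<n}"
      by (rule bij_betw_cong[THEN iffD1, rotated]) (simp add: \<sigma>_def)
    then have perm: "\<sigma> permutes {..<n}" by (rule bij_imp_permutes) (simp add: \<sigma>_def)
    have sorted: "sorted_wrt (<) (pick n T)" for T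
      by (simp add: sorted_wrt_filter)
    have \<sigma>1: "\<sigma> p = pick n S ! p" if "p < i" for p
      using that assms by (simp add: \<sigma>_def xs_def nth_append len_S)
    have \<sigma>2: "\<sigma> p = pick n (-S) ! (p - i)" if "i \<le> p" "p < n" for p
      using that by (simp add: \<sigma>_def xs_def nth_append len_S)
    have len_C: "length (pick n (-S)) = n - i" using len len_S by (simp add: xs_def)
    have "strict_mono_on {..<i} \<sigma>"
      using sorted_wrt_nth_less[OF sorted] len_S by (auto simp: strict_mono_on_def \<sigma>1)
    moreover have "strict_mono_on {i..<n} \<sigma>"
    proof (rule strict_mono_onI)
      fix r s assume rs: "r \<in> {i..<n}" "s \<in> {i..<n}" "r < s"
      then have "pick n (-S) ! (r - i) < pick n (-S) ! (s - i)"
        using len_C by (intro sorted_wrt_nth_less[OF sorted]) auto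
      then show "\<sigma> r < \<sigma> s" using rs by (simp add: \<sigma>2)
    qed
    moreover have "\<sigma> ` {..<i} = S"
    proof -
      have "\<sigma> ` {..<i} = (\<lambda>p. pick n S ! p) ` {..<i}" by (simp add: \<sigma>1)
      also have "\<dots> = set (pick n S)"
        using len_S by (metis atLeast0LessThan list.set_map map_nth set_upt)
      finally show ?thesis using set_S by simp
    qed
    ultimately show "S \<in> (\<lambda>\<sigma>. \<sigma> ` {..<i}) ` shuffle_perms i n"
      using perm by (auto simp: shuffle_perms_def)
  qed (use shuffle_perms_image(2,3)[OF _ assms] in blast)
qed

text \<open>Inversions of a shuffle occur only between its two blocks. Their values are the pairs of
  a chosen position and a smaller unchosen one, which are the terms of
  \<open>crossing\<close>.\<close>

lemma koszul_sign_shuffle: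
  assumes "\<sigma> \<in> shuffle_perms i n" "i \<le> n"
  shows "koszul_sign n e \<sigma> = (-1) powi crossing n e (\<sigma> ` {..<i})"
proof -
  let ?S = "\<sigma> ` {..<i}"
  have \<sigma>: "\<sigma> permutes {..<n}" and mono: "strict_mono_on {..<i} \<sigma>" "strict_mono_on {i..<n} \<sigma>"
    using assms by (auto simp: shuffle_perms_def)
  note inj = permutes_inj[OF \<sigma>]
  have inv: "inversions n \<sigma> = {(p, q). p < i \<and> i \<le> q \<and> q < n \<and> \<sigma> q < \<sigma> p}"
  proof -
    have "p < i \<and> i \<le> q" if "p < q" "q < n" "\<sigma> q < \<sigma> p" for p q
      using that strict_mono_onD[OF mono(1), of p q] strict_mono_onD[OF mono(2), of p q]
      by (cases "q < i"; cases "p < i") auto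
    then show ?thesis by (auto simp: inversions_def)
  qed
  \<comment> \<open>Passing from positions to values puts the larger, chosen entry first.\<close>
  have "map_prod \<sigma> \<sigma> ` inversions n \<sigma> = (SIGMA q:{q. q < n \<and> q \<in> ?S}. {p. p < q \<and> p \<notin> ?S})"
  proof (intro equalityI subsetI)
    fix z assume "z \<in> map_prod \<sigma> \<sigma> ` inversions n \<sigma>"
    then obtain p q where z: "z = (\<sigma> p, \<sigma> q)" and pq: "p < i" "i \<le> q" "q < n" "\<sigma> q < \<sigma> p"
      by (auto simp: inv)
    have "\<sigma> p \<in> ?S" "\<sigma> p < n" using pq shuffle_perms_image(2)[OF assms] by auto
    moreover have "\<sigma> q \<notin> ?S" using pq inj by (auto simp: inj_image_mem_iff)
    ultimately show "z \<in> (SIGMA q:{q. q < n \<and> q \<in> ?S}. {p. p < q \<and> p \<notin> ?S})"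
      using z pq by auto
  next
    fix z assume "z \<in> (SIGMA q:{q. q < n \<and> q \<in> ?S}. {p. p < q \<and> p \<notin> ?S})"
    then obtain p v where z: "z = (\<sigma> p, v)" "\<sigma> p < n" "p < i" "v < \<sigma> p" "v \<notin> ?S" by auto
    then have "v \<in> {..<n} - ?S" by auto
    then obtain q where "v = \<sigma> q" "q \<in> {i..<n}"
      unfolding shuffle_perms_image(1)[OF assms, symmetric] by blast
    then show "z \<in> map_prod \<sigma> \<sigma> ` inversions n \<sigma>"
      using z by (auto simp: inv intro!: image_eqI[of _ _ "(p, q)"])
  qed
  then have "crossing n e ?S = (\<Sum>(p, q)\<in>map_prod \<sigma> \<sigma> ` inversions n \<sigma>. e p * e q)"
    unfolding crossing_def by (simp add: sum.Sigma)
  also have "\<dots> = (\<Sum>(p, q)\<in>inversions n \<sigma>. e (\<sigma> p) * e (\<sigma> q))"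
    using inj_on_subset[OF prod.inj_map[OF inj inj] subset_UNIV]
    by (subst sum.reindex) (auto simp: case_prod_unfold)
  finally show ?thesis
    by (simp add: koszul_sign_inversions minus_one_powi_sum case_prod_unfold)
qed


section \<open>Graded spaces\<close>

text \<open>The property under the \<open>THE\<close> of \<open>components\<close>, named so that
  its behaviour under linear operations can be stated.\<close>

definition decomposition :: "(int \<Rightarrow> 'v::ab_group_add set) \<Rightarrow> (int \<Rightarrow> 'v) \<Rightarrow> 'v \<Rightarrow> bool" where
  "decomposition V c x \<longleftrightarrow>
     (\<forall>i. c i \<in> V i) \<and> finite {i. c i \<noteq> 0} \<and> x = (\<Sum>i | c i \<noteq> 0. c i)"

context vector_space
begin

lemma graded_space_subspace: "graded_space scale V \<Longrightarrow> subspace (V i)"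
  by (simp add: graded_space_def)

text \<open>Allowing any finite superset of the support gives two decompositions a common index set,
  even if summands cancel.\<close>

lemma decomposition_superset:
  assumes "\<forall>i. c i \<in> V i" "finite A" "{i. c i \<noteq> 0} \<subseteq> A" "x = (\<Sum>i\<in>A. c i)"
  shows "decomposition V c x"
  unfolding decomposition_def using assms
  by (auto intro: finite_subset sum.mono_neutral_right)

lemma decomposition_sum:
  assumes "decomposition V c x" "finite A" "{i. c i \<noteq> 0} \<subseteq> A" "\<And>i. f i 0 = 0"
  shows "(\<Sum>i | c i \<noteq> 0. f i (c i)) = (\<Sum>i\<in>A. f i (c i))"
  using assms by (intro sum.mono_neutral_left) auto

lemma decomposition_add:
  assumes "graded_space scale V" "decomposition V c x" "decomposition V d y"
  shows "decomposition V (\<lambda>i. c i + d i) (x + y)"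
proof (rule decomposition_superset)
  let ?A = "{i. c i \<noteq> 0} \<union> {i. d i \<noteq> 0}"
  show "\<forall>i. c i + d i \<in> V i"
    using assms by (simp add: decomposition_def graded_space_subspace subspace_add)
  show "finite ?A" using assms by (simp add: decomposition_def)
  then show "x + y = (\<Sum>i\<in>?A. c i + d i)"
    using assms decomposition_sum[of V c x ?A "\<lambda>i y. y"] decomposition_sum[of V d y ?A "\<lambda>i y. y"]
    by (simp add: decomposition_def sum.distrib)
qed auto

lemma decomposition_scale:
  assumes "graded_space scale V" "decomposition V c x"
  shows "decomposition V (\<lambda>i. scale r (c i)) (scale r x)"
proof (rule decomposition_superset)
  show "\<forall>i. scale r (c i) \<in> V i"
    using assms by (simp add: decomposition_def graded_space_subspace subspace_scale)
qed (use assms in \<open>auto simp: decomposition_def scale_sum_right\<close>)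

lemma decomposition_homogeneous:
  assumes "graded_space scale V" "x \<in> V j"
  shows "decomposition V (\<lambda>i. if i = j then x else 0) x"
proof (rule decomposition_superset[where A = "{j}"])
  show "\<forall>i. (if i = j then x else 0) \<in> V i"
    using assms by (simp add: graded_space_subspace subspace_0)
qed auto

text \<open>The decomposable vectors form a subspace containing every \<open>V i\<close>, hence
  contain the span.\<close>

lemma decomposition_exists:
  assumes "graded_space scale V" "x \<in> graded_total scale V"
  obtains c where "decomposition V c x"
proof -
  have "subspace {x. \<exists>c. decomposition V c x}"
  proof (rule subspaceI)
    show "0 \<in> {x. \<exists>c. decomposition V c x}"
      using assms decomposition_homogeneous[of V 0 0]
      by (auto simp: graded_space_subspace subspace_0)
  qed (use assms decomposition_add decomposition_scale in blast)+
  moreover have "(\<Union>i. V i) \<subseteq> {x. \<exists>c. decomposition V c x}"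
    using decomposition_homogeneous[OF assms(1)] by blast
  ultimately have "graded_total scale V \<subseteq> {x. \<exists>c. decomposition V c x}"
    unfolding graded_total_def by (intro span_minimal)
  then show thesis using assms(2) that by blast
qed

text \<open>The difference of two decompositions of \<open>x\<close> decomposes \<open>0\<close>, so
  it vanishes because the sum is direct.\<close>

lemma components_eq:
  assumes "graded_space scale V" "decomposition V c x"
  shows "components V x = c"
proof -
  have unique: "d = c" if d: "decomposition V d x" for d
  proof
    fix i
    let ?b = "\<lambda>i. d i + scale (-1) (c i)"
    have "decomposition V ?b (x + scale (-1) x)"
      using assms d by (intro decomposition_add decomposition_scale)
    then have b: "(\<forall>i. ?b i \<in> V i) \<and> finite {i. ?b i \<noteq> 0} \<and> (\<Sum>i | ?b i \<noteq> 0. ?b i) = 0"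
      by (simp add: decomposition_def)
    have "\<forall>c. (\<forall>i. c i \<in> V i) \<and> finite {i. c i \<noteq> 0} \<and> (\<Sum>i | c i \<noteq> 0. c i) = 0
        \<longrightarrow> (\<forall>i. c i = 0)"
      using assms(1) unfolding graded_space_def by (rule conjunct2)
    from this[THEN spec, THEN mp, OF b] have "?b i = 0" ..
    then show "d i = c i" by simp
  qed
  show ?thesis
    unfolding components_def decomposition_def[symmetric]
    by (rule the_equality, rule assms(2), rule unique)
qed

lemma degree_twist_decomposition:
  assumes "graded_space scale V" "decomposition V c x" "finite A" "{i. c i \<noteq> 0} \<subseteq> A"
  shows "degree_twist scale V m x = (\<Sum>i\<in>A. scale ((-1) powi (int m * i)) (c i))"
  unfolding degree_twist_def components_eq[OF assms(1,2)]
  by (rule decomposition_sum[OF assms(2-4)]) simp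

lemma degree_twist_homogeneous:
  assumes "graded_space scale V" "x \<in> V j"
  shows "degree_twist scale V m x = scale ((-1) powi (int m * j)) x"
  by (subst degree_twist_decomposition[OF assms(1) decomposition_homogeneous[OF assms], of "{j}"])
     auto

lemma degree_twist_add:
  assumes "graded_space scale V" "x \<in> graded_total scale V" "y \<in> graded_total scale V"
  shows "degree_twist scale V m (x + y) = degree_twist scale V m x + degree_twist scale V m y"
proof -
  obtain c d where cd: "decomposition V c x" "decomposition V d y"
    using decomposition_exists assms by metis
  let ?A = "{i. c i \<noteq> 0} \<union> {i. d i \<noteq> 0}"
  have "finite ?A" using cd by (simp add: decomposition_def)
  moreover have "{i. c i + d i \<noteq> 0} \<subseteq> ?A" by auto
  ultimately show ?thesis
    using degree_twist_decomposition[OF assms(1) cd(1), of ?A m]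
      degree_twist_decomposition[OF assms(1) cd(2), of ?A m]
      degree_twist_decomposition[OF assms(1) decomposition_add[OF assms(1) cd], of ?A m]
    by (simp add: scale_right_distrib sum.distrib)
qed

lemma degree_twist_scale:
  assumes "graded_space scale V" "x \<in> graded_total scale V"
  shows "degree_twist scale V m (scale r x) = scale r (degree_twist scale V m x)"
proof -
  obtain c where c: "decomposition V c x" using decomposition_exists assms by metis
  let ?A = "{i. c i \<noteq> 0}"
  have "finite ?A" using c by (simp add: decomposition_def)
  moreover have "{i. scale r (c i) \<noteq> 0} \<subseteq> ?A" by auto
  ultimately show ?thesis
    using degree_twist_decomposition[OF assms(1) c, of ?A m]
      degree_twist_decomposition[OF assms(1) decomposition_scale[OF assms(1) c], of ?A r m]
    by (simp add: scale_sum_right mult.commute)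
qed

end


section \<open>Iterated brackets\<close>

lemma sum_list_filter_upt:
  "(\<Sum>p\<leftarrow>filter Q [0..<n]. e p) = (\<Sum>p | p < n \<and> Q p. (e p :: int))"
  by (induction n) (simp_all add: Collect_less_Suc_conj)

context graded_lie_algebra
begin

sublocale left: module_hom scale scale "\<lambda>x. br x y" for y
  using linear_left by (simp add: module_hom_iff_linear)

sublocale right: module_hom scale scale "br x" for x
  using linear_right by (simp add: module_hom_iff_linear)

lemma foldl_br_linear: "module_hom scale scale (\<lambda>x. foldl br x as)"
proof (induction as)
  case (Cons a as)
  show ?case
    using module_hom_compose[OF left.module_hom_axioms[of a] Cons.IH] by (simp add: comp_def)
qed (simp add: module_hom_def module_hom_axioms_def module_axioms)

sublocale foldl_br: module_hom scale scale "\<lambda>x. foldl br x as" for as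
  by (rule foldl_br_linear)

lemma foldl_br_degree:
  assumes "D \<in> L m" "\<And>p. p \<in> set ps \<Longrightarrow> x p \<in> L (e p)"
  shows "foldl br D (map x ps) \<in> L (m + (\<Sum>p\<leftarrow>ps. e p))"
  using assms
proof (induction ps arbitrary: D m)
  case (Cons p ps)
  then have "foldl br (br D (x p)) (map x ps) \<in> L (m + e p + (\<Sum>p\<leftarrow>ps. e p))"
    by (intro Cons.IH degree) auto
  then show ?case by (simp add: add.assoc)
qed simp

lemma foldl_br_scale:
  "foldl br D (map (\<lambda>p. c p *s x p) [0..<n]) = (\<Prod>p<n. c p) *s foldl br D (map x [0..<n])"
  by (induction n) (simp_all add: left.scale right.scale mult.commute)

text \<open>In the Jacobi identity for \<open>D\<close>, \<open>a\<close>, \<open>b\<close> the term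
  with \<open>br a b\<close> vanishes, and antisymmetry moves \<open>a\<close> to the back. The
  degree of \<open>D\<close> cancels from the sign.\<close>

lemma br_swap:
  assumes "D \<in> L m" "a \<in> L i" "b \<in> L j" "br a b = 0"
  shows "br (br D a) b = (-1) powi (i * j) *s br (br D b) a"
proof -
  have "0 = br (br D a) b + (-1) powi (m * i) *s br a (br D b)"
    using jacobi[OF assms(1-3)] assms(4) by (simp add: right.zero)
  also have "br a (br D b) = - ((-1) powi (i * (m + j)) *s br (br D b) a)"
    by (intro antisym assms degree)
  also have "(-1) powi (m * i) *s (- ((-1) powi (i * (m + j)) *s br (br D b) a)) =
      - ((-1) powi (i * j) *s br (br D b) a)"
    by (auto simp: minus_one_powi)
  finally show ?thesis by simp
qed

text \<open>\<open>br_swap\<close> carries \<open>b\<close> past the \<open>x p\<close> one at a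
  time. This is how a projected bracket, the first argument of a nested bracket, is moved to the
  end.\<close>

lemma foldl_br_rotate:
  assumes "D \<in> L m" "b \<in> L j" "\<And>p. p \<in> set ps \<Longrightarrow> x p \<in> L (e p) \<and> br b (x p) = 0"
  shows "foldl br D (b # map x ps) =
           (-1) powi (j * (\<Sum>p\<leftarrow>ps. e p)) *s br (foldl br D (map x ps)) b"
  using assms
proof (induction ps arbitrary: D m)
  case (Cons p ps)
  have "foldl br D (b # map x (p # ps)) = foldl br (br (br D b) (x p)) (map x ps)" by simp
  also have "br (br D b) (x p) = (-1) powi (j * e p) *s br (br D (x p)) b"
    using Cons.prems by (intro br_swap) auto
  also have "foldl br \<dots> (map x ps) =
      (-1) powi (j * e p) *s foldl br (br D (x p)) (b # map x ps)"
    by (simp add: foldl_br.scale)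
  also have "foldl br (br D (x p)) (b # map x ps) =
      (-1) powi (j * (\<Sum>p\<leftarrow>ps. e p)) *s br (foldl br (br D (x p)) (map x ps)) b"
    using Cons.prems by (intro Cons.IH[of _ "m + e p"] degree) auto
  finally show ?case by (simp add: power_int_add algebra_simps)
qed simp

text \<open>Graded Leibniz rule for bracketing from the right: antisymmetry turns the left form of
  the Jacobi identity into it, with the sign of \<open>a\<close> passing \<open>D'\<close>.\<close>

lemma br_derivation:
  assumes "D \<in> L m" "D' \<in> L m'" "a \<in> L i"
  shows "br (br D D') a = br D (br D' a) + (-1) powi (m' * i) *s br (br D a) D'"
proof -
  have "br D (br D' a) = br (br D D') a + (-1) powi (m * m') *s br D' (br D a)"
    by (rule jacobi[OF assms])
  also have "br D' (br D a) = - ((-1) powi (m' * (m + i)) *s br (br D a) D')"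
    by (intro antisym assms degree)
  also have "(-1) powi (m * m') *s (- ((-1) powi (m' * (m + i)) *s br (br D a) D')) =
      - ((-1) powi (m' * i) *s br (br D a) D')"
    by (auto simp: minus_one_powi)
  finally show ?thesis by simp
qed

text \<open>The factor \<open>(-1)^{e(S)}\<close> comes from moving the elements indexed by \<open>S\<close> past the odd \<open>D'\<close>.\<close>

lemma foldl_br_expand:
  assumes "D \<in> L 1" "D' \<in> L 1" "\<And>p. p < n \<Longrightarrow> x p \<in> L (e p)"
  shows "foldl br (br D D') (map x [0..<n]) =
    (\<Sum>S\<in>Pow {..<n}. (-1) powi (crossing n e S + (\<Sum>p | p < n \<and> p \<in> S. e p)) *s
       br (foldl br D (map x (pick n S))) (foldl br D' (map x (pick n (-S)))))"
  using assms(3)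
proof (induction n)
  case (Suc n)
  let ?E = "\<lambda>n S. crossing n e S + (\<Sum>p | p < n \<and> p \<in> S. e p)"
  let ?D = "\<lambda>n S. foldl br D (map x (pick n S))" and ?D' = "\<lambda>n S. foldl br D' (map x (pick n (-S)))"
  let ?F = "\<lambda>n S. (-1) powi ?E n S *s br (?D n S) (?D' n S)"
  \<comment> \<open>By the Leibniz rule \<open>x n\<close> joins either the right factor, which
    keeps \<open>S\<close>, or the left factor, which inserts \<open>n\<close>.\<close>
  have step: "br (?F n S) (x n) = ?F (Suc n) S + ?F (Suc n) (insert n S)"
    if S: "S \<in> Pow {..<n}" for S
  proof -
    have n: "n \<notin> S" using S by auto
    have ins: "filter (\<lambda>p. p = n \<or> p \<in> S) [0..<n] = pick n S"
      "filter (\<lambda>p. p \<noteq> n \<and> p \<notin> S) [0..<n] = filter (\<lambda>p. p \<notin> S) [0..<n]"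
      by (auto intro!: filter_cong)
    have ins': "{p. p < n \<and> (p = n \<or> p \<in> S)} = {p. p < n \<and> p \<in> S}"
      "{p. p < n \<and> p \<noteq> n \<and> p \<notin> S} = {p. p < n \<and> p \<notin> S}"
      by auto
    have cr: "crossing n e (insert n S) = crossing n e S"
      unfolding crossing_def by (intro sum.cong refl) auto
    let ?m = "1 + (\<Sum>p | p < n \<and> p \<in> S. e p)" and ?m' = "1 + (\<Sum>p | p < n \<and> p \<notin> S. e p)"
    have D: "?D n S \<in> L ?m"
      using foldl_br_degree[OF assms(1), of "pick n S" x e] Suc.prems
      by (simp add: sum_list_filter_upt)
    have D': "?D' n S \<in> L ?m'"
      using foldl_br_degree[OF assms(2), of "pick n (-S)" x e] Suc.prems
      by (simp add: sum_list_filter_upt)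
    have "br (?F n S) (x n) = (-1) powi ?E n S *s
        (br (?D n S) (br (?D' n S) (x n)) + (-1) powi (?m' * e n) *s br (br (?D n S) (x n)) (?D' n S))"
      using br_derivation[OF D D', of "x n" "e n"] Suc.prems by (simp add: left.scale)
    \<comment> \<open>The exponent \<open>?m' * e n\<close> is the increase of
      \<open>crossing\<close> plus the increase \<open>e n\<close> of the degree sum.\<close>
    also have "\<dots> = ?F (Suc n) S + ?F (Suc n) (insert n S)"
      using n by (simp add: ins ins' cr crossing_Suc Collect_less_Suc_conj scale_right_distrib
          power_int_add[symmetric] algebra_simps)
    finally show ?thesis .
  qed
  have "foldl br (br D D') (map x [0..<Suc n]) = (\<Sum>S\<in>Pow {..<n}. br (?F n S) (x n))"
    using Suc by (simp add: left.sum)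
  also have "\<dots> = (\<Sum>S\<in>Pow {..<n}. ?F (Suc n) S) + (\<Sum>S\<in>Pow {..<n}. ?F (Suc n) (insert n S))"
    by (simp only: step sum.distrib cong: sum.cong)
  also have "(\<Sum>S\<in>Pow {..<n}. ?F (Suc n) (insert n S)) = (\<Sum>S\<in>insert n ` Pow {..<n}. ?F (Suc n) S)"
    by (subst sum.reindex) (auto simp: inj_on_def)
  also have "(\<Sum>S\<in>Pow {..<n}. ?F (Suc n) S) + \<dots> = (\<Sum>S\<in>Pow {..<Suc n}. ?F (Suc n) S)"
    by (subst sum.union_disjoint[symmetric]) (auto simp: lessThan_Suc Pow_insert)
  finally show ?case .
qed simp

end


section \<open>Derived brackets\<close>

lemma upt_split: "i < k \<Longrightarrow> [0..<k] = [0..<i] @ i # [Suc i..<k]"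
  using upt_add_eq_append[of 0 i "k - i"] by (simp add: upt_conv_Cons)

context V_data
begin

sublocale P: module_hom scale scale P
  using P_linear by (simp add: module_hom_iff_linear)

lemma P_mem: "P x \<in> \<aa>"
  using P_image by blast

lemma subspace_\<aa>: "subspace \<aa>"
proof -
  have "\<aa> = graded_total scale (\<lambda>i. \<aa> \<inter> L i)"
    using subalgebra by (simp add: graded_lie_subalgebra_def)
  then show ?thesis unfolding graded_total_def by (metis subspace_span)
qed

text \<open>Expand the bracket of the kernel parts \<open>x - P x\<close> and
  \<open>y - P y\<close>, which \<open>P\<close> kills; the term \<open>br (P x) (P y)\<close> is
  zero.\<close>

lemma P_br: "P (br x y) = P (br (P x) y) + P (br x (P y))"
proof -
  have "P (br (x - P x) (y - P y)) = 0"
    using P_kernel by (simp add: graded_lie_subalgebra_def P.diff P_proj)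
  moreover have "br (P x) (P y) = 0" by (intro abelian P_mem)
  ultimately show ?thesis by (simp add: left.diff right.diff P.diff P.add algebra_simps)
qed

lemma rho_linear: "module_hom scale scale (\<lambda>y. rho br P \<Delta> (as @ y # bs))"
proof -
  have "module_hom scale scale (\<lambda>y. P (foldl br (br (foldl br \<Delta> as) y) bs))"
    using module_hom_compose[OF right.module_hom_axioms
        module_hom_compose[OF foldl_br.module_hom_axioms P.module_hom_axioms]]
    by (simp add: comp_def)
  then show ?thesis by (simp add: rho_def)
qed

lemma rho_degree:
  assumes "\<And>p. p \<in> set ps \<Longrightarrow> x p \<in> L (e p)"
  shows "rho br P \<Delta> (map x ps) \<in> \<aa> \<inter> L (1 + (\<Sum>p\<leftarrow>ps. e p))"
  unfolding rho_def by (intro IntI P_mem P_degree foldl_br_degree Delta_degree assms)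

lemma rho_scale:
  "rho br P \<Delta> (map (\<lambda>p. c p *s x p) [0..<n]) = (\<Prod>p<n. c p) *s rho br P \<Delta> (map x [0..<n])"
  by (simp add: rho_def foldl_br_scale P.scale)

lemma graded_suspended: "graded_space scale (suspended L \<aa>)"
  unfolding graded_space_def
proof (intro conjI allI impI)
  show "subspace (suspended L \<aa> i)" for i
    unfolding suspended_def suspension_def
    by (intro subspace_inter subspace_\<aa> graded_space_subspace graded)
  fix c j assume c: "(\<forall>i. c i \<in> suspended L \<aa> i) \<and> finite {i. c i \<noteq> 0} \<and> (\<Sum>i | c i \<noteq> 0. c i) = 0"
  \<comment> \<open>Shifting the index by one undoes the suspension and reduces the claim to
    directness of the grading \<open>L\<close>.\<close>
  define b where "b i = c (i + 1)" for i
  have "{i. c i \<noteq> 0} = (\<lambda>i. i + 1) ` {i. b i \<noteq> 0}"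
  proof (intro equalityI subsetI)
    fix i assume "i \<in> {i. c i \<noteq> 0}"
    then show "i \<in> (\<lambda>i. i + 1) ` {i. b i \<noteq> 0}"
      by (intro image_eqI[of _ _ "i - 1"]) (auto simp: b_def)
  qed (auto simp: b_def)
  then have "finite {i. b i \<noteq> 0}" "(\<Sum>i | b i \<noteq> 0. b i) = 0"
    using c by (auto simp: finite_image_iff inj_on_def sum.reindex b_def)
  moreover have "\<forall>i. b i \<in> L i"
  proof
    fix i
    have "c (i + 1) \<in> suspended L \<aa> (i + 1)" using c by blast
    then show "b i \<in> L i" by (simp add: b_def suspended_def suspension_def)
  qed
  ultimately have "(\<forall>i. b i \<in> L i) \<and> finite {i. b i \<noteq> 0} \<and> (\<Sum>i | b i \<noteq> 0. b i) = 0" by blast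
  from graded[unfolded graded_space_def, THEN conjunct2, THEN spec, THEN mp, OF this]
  have "b (j - 1) = 0" ..
  then show "c j = 0" by (simp add: b_def)
qed

section \<open>Multilinearity, degree and skew symmetry of the derived brackets\<close>

lemma suspendedD:
  assumes "x \<in> suspended L \<aa> i"
  shows "x \<in> \<aa>" "x \<in> L (i - 1)"
  using assms by (auto simp: suspended_def suspension_def)

text \<open>On homogeneous arguments every twist is a scalar, and the scalars multiply to the
  decalage sign.\<close>

lemma derived_bracket_homogeneous:
  assumes "\<And>p. p < k \<Longrightarrow> x p \<in> suspended L \<aa> (d p)"
  shows "derived_bracket scale L br \<aa> P \<Delta> k (map x [0..<k]) =
           (-1) powi decalage k d *s rho br P \<Delta> (map x [0..<k])"
proof -
  have twist: "map (\<lambda>p. degree_twist scale (suspended L \<aa>) (k - 1 - p) (map x [0..<k] ! p)) [0..<k] =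
        map (\<lambda>p. (-1) powi (int (k - 1 - p) * d p) *s x p) [0..<k]"
    using degree_twist_homogeneous[OF graded_suspended assms] by simp
  show ?thesis
    by (simp only: derived_bracket_def twist rho_scale decalage_def minus_one_powi_sum)
qed

lemma derived_bracket_multilinear:
  "multilinear_on scale (graded_total scale (suspended L \<aa>)) k (derived_bracket scale L br \<aa> P \<Delta> k)"
  unfolding multilinear_on_def
proof (intro allI impI, elim conjE)
  let ?V = "suspended L \<aa>"
  fix xs ys :: "'v list" and u v :: 'v and c :: 'k
  assume T: "u \<in> graded_total scale ?V" "v \<in> graded_total scale ?V"
    and k: "length xs + 1 + length ys = k"
  let ?t = "\<lambda>p. degree_twist scale ?V (k - 1 - p)"
  \<comment> \<open>Isolates slot \<open>length xs\<close>; the twist in a slot depends only on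
    \<open>k\<close> and the position, so the other entries stay fixed as \<open>y\<close>
    varies.\<close>
  have split: "derived_bracket scale L br \<aa> P \<Delta> k (xs @ y # ys) =
      rho br P \<Delta> (map (\<lambda>p. ?t p (xs ! p)) [0..<length xs] @ ?t (length xs) y #
        map (\<lambda>q. ?t (Suc (length xs + q)) (ys ! q)) [0..<length ys])" for y :: 'v
  proof -
    have "[0..<k] = [0..<length xs] @ length xs # map (\<lambda>q. q + Suc (length xs)) [0..<length ys]"
      unfolding map_add_upt k[symmetric] by (subst upt_split[of "length xs"]) (simp_all add: add.commute)
    then show ?thesis
      unfolding derived_bracket_def 
      by (auto simp: nth_append comp_def add.commute intro!: arg_cong[of _ _ "rho br P \<Delta>"])
  qed
  note hom = module_hom.add[OF rho_linear] module_hom.scale[OF rho_linear]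
  show "derived_bracket scale L br \<aa> P \<Delta> k (xs @ (u + v) # ys) =
      derived_bracket scale L br \<aa> P \<Delta> k (xs @ u # ys) +
      derived_bracket scale L br \<aa> P \<Delta> k (xs @ v # ys) \<and>
    derived_bracket scale L br \<aa> P \<Delta> k (xs @ c *s u # ys) =
      c *s derived_bracket scale L br \<aa> P \<Delta> k (xs @ u # ys)"
    unfolding split degree_twist_add[OF graded_suspended T]
      degree_twist_scale[OF graded_suspended T(1)] hom by simp
qed

lemma derived_bracket_degree:
  assumes "\<And>p. p < k \<Longrightarrow> x p \<in> suspended L \<aa> (d p)"
  shows "derived_bracket scale L br \<aa> P \<Delta> k (map x [0..<k]) \<in>
           suspended L \<aa> ((\<Sum>p<k. d p) + 2 - int k)"
proof -
  have "rho br P \<Delta> (map x [0..<k]) \<in> \<aa> \<inter> L (1 + (\<Sum>p\<leftarrow>[0..<k]. d p - 1))"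
    using suspendedD(2)[OF assms] by (intro rho_degree) simp
  \<comment> \<open>The summand \<open>1\<close> is the degree of \<open>\<Delta>\<close>, each
    argument loses one degree in \<open>\<aa>\<close>, and the final \<open>- 1\<close> undoes the
    suspension of the value.\<close>
  also have "1 + (\<Sum>p\<leftarrow>[0..<k]. d p - 1) = (\<Sum>p<k. d p) + 2 - int k - 1"
    by (simp add: sum_list_distinct_conv_sum_set atLeast0LessThan sum_subtractf)
  finally have "rho br P \<Delta> (map x [0..<k]) \<in> suspended L \<aa> ((\<Sum>p<k. d p) + 2 - int k)"
    by (simp add: suspended_def suspension_def)
  then show ?thesis
    by (simp only: derived_bracket_homogeneous[OF assms] subspace_scale
        graded_space_subspace graded_suspended)
qed

text \<open>Adjacent swaps suffice. For them \<open>\<rho>\<close> is graded symmetric in the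
  degrees of \<open>\<aa>\<close>, by \<open>br_swap\<close> and commutativity of
  \<open>\<aa>\<close>, and the change of the decalage sign makes this skew.\<close>

lemma derived_bracket_skew:
  assumes x: "\<And>p. p < k \<Longrightarrow> x p \<in> suspended L \<aa> (d p)" and \<sigma>: "\<sigma> permutes {..<k}"
  shows "derived_bracket scale L br \<aa> P \<Delta> k (map (\<lambda>p. x (\<sigma> p)) [0..<k]) =
           chi k d \<sigma> *s derived_bracket scale L br \<aa> P \<Delta> k (map x [0..<k])"
  using \<sigma>
proof (induction rule: adjacent_transposition_induct)
  case id
  show ?case unfolding chi_id by simp
next
  case (step \<sigma> i)
  let ?l = "derived_bracket scale L br \<aa> P \<Delta> k" and ?t = "transpose i (Suc i)"
  let ?x = "x \<circ> \<sigma>" and ?d = "d \<circ> \<sigma>"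
  have t: "?t permutes {..<k}" using step(2) by (intro permutes_swap_id) auto
  have x\<sigma>: "?x p \<in> suspended L \<aa> (?d p)" if "p < k" for p
    using x[of "\<sigma> p"] permutes_in_image[OF step(1)] that by simp
  have xt: "(?x \<circ> ?t) p \<in> suspended L \<aa> ((?d \<circ> ?t) p)" if "p < k" for p
    using x\<sigma>[of "?t p"] permutes_in_image[OF t] that by simp
  have upt: "[0..<k] = [0..<i] @ i # Suc i # [Suc (Suc i)..<k]"
    using step(2) upt_split[of i k] upt_conv_Cons[of "Suc i" k] by simp
  let ?D = "foldl br \<Delta> (map ?x [0..<i])"
  have D: "?D \<in> L (1 + (\<Sum>p\<leftarrow>[0..<i]. ?d p - 1))"
    using suspendedD(2)[OF x\<sigma>] step(2) by (intro foldl_br_degree Delta_degree) simp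
  have "br (br ?D (?x (Suc i))) (?x i) =
      (-1) powi ((?d (Suc i) - 1) * (?d i - 1)) *s br (br ?D (?x i)) (?x (Suc i))"
    using suspendedD[OF x\<sigma>] step(2) by (intro br_swap[OF D] abelian) simp_all
  moreover have "(?x \<circ> ?t) i = ?x (Suc i)" "(?x \<circ> ?t) (Suc i) = ?x i"
    "map (?x \<circ> ?t) [0..<i] = map ?x [0..<i]"
    "map (?x \<circ> ?t) [Suc (Suc i)..<k] = map ?x [Suc (Suc i)..<k]"
    by (auto simp: transpose_def)
  ultimately have "rho br P \<Delta> (map (?x \<circ> ?t) [0..<k]) =
      (-1) powi ((?d (Suc i) - 1) * (?d i - 1)) *s rho br P \<Delta> (map ?x [0..<k])"
    by (simp only: upt rho_def map_append list.map foldl_append foldl_Cons foldl_br.scale P.scale)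
  then have "?l (map (?x \<circ> ?t) [0..<k]) =
      (-1) powi (decalage k ?d + ?d (Suc i) - ?d i + (?d (Suc i) - 1) * (?d i - 1)) *s
        rho br P \<Delta> (map ?x [0..<k])"
    by (simp only: derived_bracket_homogeneous[OF xt] decalage_comp_transpose[OF step(2)])
       (simp add: power_int_add)
  also have "(-1 :: 'k) powi (decalage k ?d + ?d (Suc i) - ?d i + (?d (Suc i) - 1) * (?d i - 1)) =
      - ((-1) powi (?d i * ?d (Suc i)) * (-1) powi decalage k ?d)"
    by (auto simp: minus_one_powi)
  also have "- ((-1) powi (?d i * ?d (Suc i)) * (-1) powi decalage k ?d) *s
      rho br P \<Delta> (map ?x [0..<k]) = - ((-1) powi (?d i * ?d (Suc i))) *s ?l (map ?x [0..<k])"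
    by (simp only: derived_bracket_homogeneous[OF x\<sigma>] scale_scale mult_minus_left)
  also have "?l (map ?x [0..<k]) = chi k d \<sigma> *s ?l (map x [0..<k])"
    using step.IH by (simp add: comp_def)
  finally show ?case
    unfolding chi_comp_transpose[OF step(1-3)] by (simp add: comp_def)
qed

end


section \<open>The compatibility identity\<close>

lemma crossing_cong:
  assumes "\<And>p. p < n \<Longrightarrow> p \<in> S \<longleftrightarrow> p \<in> T"
  shows "crossing n e S = crossing n e T"
  unfolding crossing_def using assms by (intro sum.cong Collect_cong) auto

text \<open>Each of the first \<open>i\<close> entries is additionally followed by the
  \<open>m\<close> later ones; the weights in the second block are unaffected.\<close>

lemma decalage_add:
  "decalage (i + m) f = int m * (\<Sum>p<i. f p) + decalage i f + decalage m (\<lambda>q. f (i + q))"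
proof -
  have split: "(\<Sum>p<i + m. g p) = (\<Sum>p<i. g p) + (\<Sum>q<m. g (i + q))" for g :: "nat \<Rightarrow> int"
    by (induction m) (simp_all add: add.assoc)
  have "(\<Sum>p<i. int (i + m - 1 - p) * f p) = (\<Sum>p<i. int m * f p + int (i - 1 - p) * f p)"
    by (intro sum.cong) (auto simp: of_nat_diff algebra_simps)
  moreover have "(\<Sum>q<m. int (i + m - 1 - (i + q)) * f (i + q)) = decalage m (\<lambda>q. f (i + q))"
    unfolding decalage_def by (intro sum.cong) auto
  ultimately have "decalage (i + m) f = (\<Sum>p<i. int m * f p + int (i - 1 - p) * f p) +
      decalage m (\<lambda>q. f (i + q))"
    by (simp only: decalage_def[of "i + m"] split)
  then show ?thesis by (simp add: decalage_def[of i] sum.distrib sum_distrib_left)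
qed

lemma decalage_Suc: "decalage (Suc m) f = int m * f 0 + decalage m (\<lambda>q. f (Suc q))"
  using decalage_add[of 1 m f] by (simp add: decalage_def)

text \<open>Subsets are grouped by size. Sizes start at \<open>1\<close>, as inner brackets have at
  least one argument, so the empty set must contribute zero.\<close>

lemma sum_card_fibres:
  assumes "f {} = 0"
  shows "(\<Sum>i=1..n. \<Sum>S | S \<subseteq> {..<n} \<and> card S = i. f S) = (\<Sum>S\<in>Pow {..<n}. f S)"
proof -
  have "(\<Sum>S\<in>Pow {..<n}. f S) = (\<Sum>S\<in>Pow {..<n} - {{}}. f S)"
    using assms by (intro sum.mono_neutral_right) auto
  also have "\<dots> = (\<Sum>i=1..n. \<Sum>S | S \<in> Pow {..<n} - {{}} \<and> card S = i. f S)"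
  proof (rule sum.group[symmetric])
    show "card ` (Pow {..<n} - {{}}) \<subseteq> {1..n}"
    proof
      fix i assume "i \<in> card ` (Pow {..<n} - {{}})"
      then obtain S where S: "i = card S" "S \<subseteq> {..<n}" "S \<noteq> {}" by auto
      then show "i \<in> {1..n}"
        using card_mono[of "{..<n}" S] finite_subset[of S "{..<n}"] by (auto simp: Suc_le_eq card_gt_0_iff)
    qed
  qed auto
  also have "\<dots> = (\<Sum>i=1..n. \<Sum>S | S \<subseteq> {..<n} \<and> card S = i. f S)"
    by (intro sum.cong refl) auto
  finally show ?thesis ..
qed

context compatible_V_data
begin

text \<open>Unsuspended analogue of \<open>nested\<close>, indexed by subsets instead of shuffles;
  \<open>D\<close> belongs to the outer bracket and \<open>D'\<close> to the inner one.\<close>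

definition nested_rho :: "'v \<Rightarrow> 'v \<Rightarrow> (nat \<Rightarrow> 'v) \<Rightarrow> nat \<Rightarrow> nat set \<Rightarrow> 'v" where
  "nested_rho D D' x n S =
     rho br P D (rho br P D' (map x (pick n S)) # map x (pick n (-S)))"

lemma nested_rho_cong:
  assumes "\<And>p. p < n \<Longrightarrow> p \<in> S \<longleftrightarrow> p \<in> T"
  shows "nested_rho D D' x n S = nested_rho D D' x n T"
proof -
  have "pick n S = pick n T" "pick n (-S) = pick n (-T)"
    using assms by (auto intro!: filter_cong)
  then show ?thesis unfolding nested_rho_def by metis
qed

text \<open>Each summand of \<open>foldl_br_expand\<close> splits under \<open>P\<close> into the two kinds of nested brackets,
  because \<open>P[u, v] = P[P u, v] + P[u, P v]\<close>.\<close>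

lemma P_br_foldl:
  assumes "\<And>p. p < n \<Longrightarrow> x p \<in> \<aa> \<inter> L (e p)"
  shows "(-1) powi (crossing n e S + (\<Sum>p | p < n \<and> p \<in> S. e p)) *s
      P (br (foldl br \<Delta> (map x (pick n S))) (foldl br \<Delta>' (map x (pick n (-S))))) =
    (-1) powi crossing n e S *s nested_rho \<Delta>' \<Delta> x n S +
    (-1) powi crossing n e (-S) *s nested_rho \<Delta> \<Delta>' x n (-S)"
proof -
  let ?s = "\<Sum>p | p < n \<and> p \<in> S. e p" and ?t = "\<Sum>p | p < n \<and> p \<notin> S. e p"
  let ?D = "foldl br \<Delta> (map x (pick n S))" and ?D' = "foldl br \<Delta>' (map x (pick n (-S)))"
  have D: "?D \<in> L (1 + ?s)"
    using foldl_br_degree[OF Delta_degree, of "pick n S" x e] assms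
    by (simp add: sum_list_filter_upt)
  have D': "?D' \<in> L (1 + ?t)"
    using foldl_br_degree[OF prime.Delta_degree, of "pick n (-S)" x e] assms
    by (simp add: sum_list_filter_upt)
  have "nested_rho \<Delta> \<Delta>' x n (-S) = P (foldl br \<Delta> (P ?D' # map x (pick n S)))"
    by (simp add: nested_rho_def rho_def)
  \<comment> \<open>\<open>P ?D'\<close> lies in \<open>\<aa>\<close> and so commutes with every
    \<open>x p\<close>.\<close>
  also have "foldl br \<Delta> (P ?D' # map x (pick n S)) =
      (-1) powi ((1 + ?t) * (\<Sum>p\<leftarrow>pick n S. e p)) *s br ?D (P ?D')"
    using assms by (intro foldl_br_rotate[OF Delta_degree] P_degree[OF D'])
      (auto intro: abelian P_mem)
  also have "(\<Sum>p\<leftarrow>pick n S. e p) = ?s" by (simp add: sum_list_filter_upt)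
  finally have 1: "nested_rho \<Delta> \<Delta>' x n (-S) = (-1) powi ((1 + ?t) * ?s) *s P (br ?D (P ?D'))"
    by (simp add: P.scale)
  have "nested_rho \<Delta>' \<Delta> x n S = P (foldl br \<Delta>' (P ?D # map x (pick n (-S))))"
    by (simp add: nested_rho_def rho_def)
  also have "foldl br \<Delta>' (P ?D # map x (pick n (-S))) =
      (-1) powi ((1 + ?s) * (\<Sum>p\<leftarrow>pick n (-S). e p)) *s br ?D' (P ?D)"
    using assms by (intro foldl_br_rotate[OF prime.Delta_degree] P_degree[OF D])
      (auto intro: abelian P_mem)
  also have "(\<Sum>p\<leftarrow>pick n (-S). e p) = ?t" by (simp add: sum_list_filter_upt)
  also have "br ?D' (P ?D) = - ((-1) powi ((1 + ?t) * (1 + ?s)) *s br (P ?D) ?D')"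
    by (intro antisym D' P_degree D)
  finally have "nested_rho \<Delta>' \<Delta> x n S =
      (-1) powi ((1 + ?s) * ?t) *s (- ((-1) powi ((1 + ?t) * (1 + ?s)) *s P (br (P ?D) ?D')))"
    by (simp only: P.scale P.neg)
  \<comment> \<open>Modulo 2, \<open>(1 + s) * t + (1 + t) * (1 + s) + 1\<close> equals
    \<open>s\<close>.\<close>
  also have "\<dots> = (-1) powi ?s *s P (br (P ?D) ?D')"
    by (auto simp: minus_one_powi)
  finally have 2: "nested_rho \<Delta>' \<Delta> x n S = (-1) powi ?s *s P (br (P ?D) ?D')" .
  \<comment> \<open>\<open>crossing_compl\<close> trades the crossings of \<open>S\<close> for those
    of \<open>-S\<close>; the even last term does not affect the sign.\<close>
  have "crossing n e S + ?s = crossing n e (-S) + (1 + ?t) * ?s + 2 * (- crossing n e (-S))"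
    using crossing_compl[of n e S] by (simp add: algebra_simps)
  then have 3: "(-1 :: 'k) powi (crossing n e S + ?s) = (-1) powi (crossing n e (-S) + (1 + ?t) * ?s)"
    by (rule minus_one_powi_cong)
  have "(-1) powi (crossing n e S + ?s) *s P (br ?D ?D') =
      (-1) powi (crossing n e S + ?s) *s P (br (P ?D) ?D') +
      (-1) powi (crossing n e S + ?s) *s P (br ?D (P ?D'))"
    by (subst P_br) (rule scale_right_distrib)
  also have "(-1) powi (crossing n e S + ?s) *s P (br ?D (P ?D')) =
      (-1) powi crossing n e (-S) *s nested_rho \<Delta> \<Delta>' x n (-S)"
    unfolding 1 3 by (simp add: power_int_add)
  also have "(-1) powi (crossing n e S + ?s) *s P (br (P ?D) ?D') =
      (-1) powi crossing n e S *s nested_rho \<Delta>' \<Delta> x n S"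
    unfolding 2 by (simp add: power_int_add)
  finally show ?thesis .
qed

text \<open>Apply \<open>P\<close> to the expansion of the vanishing bracket. It yields one family
  indexed by \<open>S\<close> and one by \<open>-S\<close>, which complementation aligns.\<close>

lemma nested_rho_sum:
  assumes "\<And>p. p < n \<Longrightarrow> x p \<in> \<aa> \<inter> L (e p)"
  shows "(\<Sum>S\<in>Pow {..<n}. (-1) powi crossing n e S *s
            (nested_rho \<Delta> \<Delta>' x n S + nested_rho \<Delta>' \<Delta> x n S)) = 0"
proof -
  let ?F = "\<lambda>D D' S. (-1) powi crossing n e S *s nested_rho D D' x n S"
  have "foldl br (br \<Delta> \<Delta>') (map x [0..<n]) = 0"
    by (simp add: compatible foldl_br.zero)
  then have "0 = P (foldl br (br \<Delta> \<Delta>') (map x [0..<n]))" by (simp add: P.zero)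
  also have "\<dots> = (\<Sum>S\<in>Pow {..<n}. ?F \<Delta>' \<Delta> S + ?F \<Delta> \<Delta>' (-S))"
    using assms by (subst foldl_br_expand[OF Delta_degree prime.Delta_degree, of n x e])
      (simp_all only: P.sum P.scale P_br_foldl[OF assms] Int_iff)
  also have "\<dots> = (\<Sum>S\<in>Pow {..<n}. ?F \<Delta>' \<Delta> S) + (\<Sum>S\<in>Pow {..<n}. ?F \<Delta> \<Delta>' (-S))"
    by (rule sum.distrib)
  \<comment> \<open>Complementation in \<open>{..<n}\<close> is an involution of the subsets, and
    the terms only see positions below \<open>n\<close>.\<close>
  also have "(\<Sum>S\<in>Pow {..<n}. ?F \<Delta> \<Delta>' (-S)) = (\<Sum>S\<in>Pow {..<n}. ?F \<Delta> \<Delta>' S)"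
  proof (rule sum.reindex_bij_witness[of _ "\<lambda>S. {..<n} - S" "\<lambda>S. {..<n} - S"])
    fix S assume "S \<in> Pow {..<n}"
    show "?F \<Delta> \<Delta>' ({..<n} - S) = ?F \<Delta> \<Delta>' (-S)"
      using crossing_cong[of n "{..<n} - S" "-S" e] nested_rho_cong[of n "{..<n} - S" "-S"]
      by simp
  qed auto
  finally show ?thesis by (simp add: scale_right_distrib sum.distrib add.commute)
qed

text \<open>All suspension signs combine into \<open>decalage n d\<close>, which does not depend on
  the shuffle, leaving the Koszul sign for the degrees in \<open>\<aa>\<close>.\<close>

lemma nested_derived_bracket:
  assumes x: "\<And>p. p < n \<Longrightarrow> x p \<in> suspended L \<aa> (d p)"
    and \<sigma>: "\<sigma> \<in> shuffle_perms i n" and ij: "1 \<le> i" "1 \<le> j" "i + j = n + 1"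
  shows "(chi n d \<sigma> * (-1) ^ (i * (j - 1))) *s
      nested (derived_bracket scale L br \<aa> P \<Delta>) (derived_bracket scale L br \<aa> P \<Delta>') n x \<sigma> i j =
    (-1) powi decalage n d *s (-1) powi crossing n (\<lambda>p. d p - 1) (\<sigma> ` {..<i}) *s
      nested_rho \<Delta> \<Delta>' x n (\<sigma> ` {..<i})"
proof -
  obtain m where j: "j = Suc m" and n: "n = i + m" using ij by (cases j) auto
  have perm: "\<sigma> permutes {..<n}" using \<sigma> by (simp add: shuffle_perms_def)
  let ?x = "x \<circ> \<sigma>" and ?d = "d \<circ> \<sigma>" and ?S = "\<sigma> ` {..<i}"
  have x\<sigma>: "?x p \<in> suspended L \<aa> (?d p)" if "p < n" for p
    using x[of "\<sigma> p"] permutes_in_image[OF perm] that by simp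
  have x\<sigma>i: "?x p \<in> suspended L \<aa> (?d p)" if "p < i" for p
    using x\<sigma> that n by simp
  define y where "y = derived_bracket scale L br \<aa> P \<Delta>' i (map ?x [0..<i])"
  have pick: "map ?x [0..<i] = map x (pick n ?S)" "map ?x [i..<n] = map x (pick n (-?S))"
    unfolding map_map[symmetric] using shuffle_perms_pick[OF \<sigma>] n by simp_all
  have y_eq: "y = (-1) powi decalage i ?d *s rho br P \<Delta>' (map x (pick n ?S))"
    using prime.derived_bracket_homogeneous[of i ?x ?d, OF x\<sigma>i] by (simp only: y_def pick)
  have y: "y \<in> suspended L \<aa> ((\<Sum>p<i. ?d p) + 2 - int i)"
    unfolding y_def by (rule prime.derived_bracket_degree[OF x\<sigma>i])
  \<comment> \<open>The arguments of the outer bracket as one family, the inner value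
    \<open>y\<close> at position \<open>0\<close>, with degrees \<open>dz\<close>.\<close>
  define z where "z = case_nat y (\<lambda>q. ?x (i + q))"
  define dz where "dz = case_nat ((\<Sum>p<i. ?d p) + 2 - int i) (\<lambda>q. ?d (i + q))"
  have z: "z p \<in> suspended L \<aa> (dz p)" if "p < j" for p
    using that y x\<sigma> by (cases p) (auto simp: z_def dz_def j n)
  have map_z: "map z [0..<j] = y # map ?x [i..<n]"
  proof -
    have "[0..<j] = 0 # map Suc [0..<m]" by (simp add: j map_Suc_upt upt_conv_Cons)
    moreover have "[i..<n] = map (\<lambda>q. q + i) [0..<m]" by (simp add: map_add_upt n add.commute)
    ultimately show ?thesis by (simp add: z_def comp_def add.commute)
  qed
  have "nested (derived_bracket scale L br \<aa> P \<Delta>) (derived_bracket scale L br \<aa> P \<Delta>') n x \<sigma> i j =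
      derived_bracket scale L br \<aa> P \<Delta> j (map z [0..<j])"
    unfolding map_z by (simp add: nested_def y_def comp_def)
  also have "\<dots> = (-1) powi decalage j dz *s rho br P \<Delta> (y # map x (pick n (-?S)))"
    using derived_bracket_homogeneous[of j z dz, OF z] by (simp only: map_z pick)
  also have "rho br P \<Delta> (y # map x (pick n (-?S))) =
      (-1) powi decalage i ?d *s nested_rho \<Delta> \<Delta>' x n ?S"
    using module_hom.scale[OF rho_linear[of "[]"]] by (simp add: y_eq nested_rho_def)
  finally have "nested (derived_bracket scale L br \<aa> P \<Delta>) (derived_bracket scale L br \<aa> P \<Delta>') n x \<sigma> i j =
      (-1) powi (decalage j dz + decalage i ?d) *s nested_rho \<Delta> \<Delta>' x n ?S"
    by (simp add: power_int_add)
  \<comment> \<open>The degree of \<open>y\<close> has weight \<open>m = j - 1\<close>; its part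
    \<open>- int i\<close> cancels \<open>i * m\<close>, and its part \<open>2\<close> is
    even.\<close>
  moreover have "(-1 :: 'k) ^ (i * (j - 1)) * (-1) powi (decalage j dz + decalage i ?d) =
      (-1) powi decalage n ?d"
  proof -
    have "decalage j dz = int m * ((\<Sum>p<i. ?d p) + 2 - int i) + decalage m (\<lambda>q. ?d (i + q))"
      by (simp add: j decalage_Suc dz_def)
    then have "int (i * m) + (decalage j dz + decalage i ?d) = decalage n ?d + 2 * int m"
      by (simp add: n decalage_add algebra_simps)
    then have "(-1 :: 'k) powi (int (i * m) + (decalage j dz + decalage i ?d)) =
        (-1) powi decalage n ?d"
      by (rule minus_one_powi_cong)
    then show ?thesis by (simp add: j power_int_add power_int_of_nat[symmetric] del: power_int_of_nat)
  qed
  ultimately have "(chi n d \<sigma> * (-1) ^ (i * (j - 1))) *s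
      nested (derived_bracket scale L br \<aa> P \<Delta>) (derived_bracket scale L br \<aa> P \<Delta>') n x \<sigma> i j =
      (chi n d \<sigma> * (-1) powi decalage n ?d) *s nested_rho \<Delta> \<Delta>' x n ?S"
    by (simp add: mult.assoc)
  moreover have "i \<le> n" using n by simp
  ultimately show ?thesis
    by (simp only: scale_scale chi_decalage[OF perm] koszul_sign_shuffle[OF \<sigma>])
qed

end

section \<open>From subsets back to Jacobi sums\<close>

text \<open>The bracket is symmetric on two elements of degree 1.\<close>

lemma compatible_V_data_commute:
  assumes "compatible_V_data scale L br \<aa> P \<Delta> \<Delta>'"
  shows "compatible_V_data scale L br \<aa> P \<Delta>' \<Delta>"
proof -
  interpret compatible_V_data scale L br \<aa> P \<Delta> \<Delta>' by fact
  have "br \<Delta>' \<Delta> = 0"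
    using antisym[OF prime.Delta_degree Delta_degree] compatible by simp
  then show ?thesis by unfold_locales
qed

text \<open>After the common sign is factored out, the sum over shuffles of all sizes is the subset
  sum of \<open>nested_rho_sum\<close>.\<close>

lemma (in compatible_V_data) jacobi_sum_derived_bracket:
  assumes x: "\<And>p. p < n \<Longrightarrow> x p \<in> suspended L \<aa> (d p)"
  defines "l \<equiv> derived_bracket scale L br \<aa> P \<Delta>" and "l' \<equiv> derived_bracket scale L br \<aa> P \<Delta>'"
  shows "jacobi_sum scale n d (\<lambda>\<sigma> i j. nested l l' n x \<sigma> i j + nested l' l n x \<sigma> i j) = 0"
proof -
  interpret swapped: compatible_V_data scale L br \<aa> P \<Delta>' \<Delta>
    by (rule compatible_V_data_commute) unfold_locales
  let ?G = "\<lambda>S. (-1) powi crossing n (\<lambda>p. d p - 1) S *s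
              (nested_rho \<Delta> \<Delta>' x n S + nested_rho \<Delta>' \<Delta> x n S)"
  have summand: "(chi n d \<sigma> * (-1) ^ (i * (j - 1))) *s (nested l l' n x \<sigma> i j + nested l' l n x \<sigma> i j) =
      (-1) powi decalage n d *s ?G (\<sigma> ` {..<i})"
    if "1 \<le> i" "1 \<le> j" "i + j = n + 1" "\<sigma> \<in> shuffle_perms i n" for i j \<sigma>
    using nested_derived_bracket[of n x d \<sigma> i j, OF x that(4,1-3)]
      swapped.nested_derived_bracket[of n x d \<sigma> i j, OF x that(4,1-3)]
    by (simp only: l_def l'_def scale_right_distrib)
  have "jacobi_sum scale n d (\<lambda>\<sigma> i j. nested l l' n x \<sigma> i j + nested l' l n x \<sigma> i j) =
      (\<Sum>(i, j)\<in>{(i, j). 1 \<le> i \<and> 1 \<le> j \<and> i + j = n + 1}.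
         \<Sum>\<sigma>\<in>shuffle_perms i n. (-1) powi decalage n d *s ?G (\<sigma> ` {..<i}))"
    unfolding jacobi_sum_def
    unfolding case_prod_unfold by (intro sum.cong refl summand) auto
  also have "\<dots> = (\<Sum>i=1..n. \<Sum>\<sigma>\<in>shuffle_perms i n. (-1) powi decalage n d *s ?G (\<sigma> ` {..<i}))"
    by (rule sum.reindex_bij_witness[of _ "\<lambda>i. (i, n + 1 - i)" fst]) auto
  also have "\<dots> = (\<Sum>i=1..n. \<Sum>S | S \<subseteq> {..<n} \<and> card S = i. (-1) powi decalage n d *s ?G S)"
    by (intro sum.cong refl sum.reindex_bij_betw bij_betw_shuffle_perms) simp
  also have "\<dots> = (\<Sum>S\<in>Pow {..<n}. (-1) powi decalage n d *s ?G S)"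
  proof (rule sum_card_fibres)
    \<comment> \<open>For the empty subset the inner bracket is \<open>P \<Delta>'\<close> or
      \<open>P \<Delta>\<close>, which is zero.\<close>
    have "nested_rho \<Delta> \<Delta>' x n {} = 0" "nested_rho \<Delta>' \<Delta> x n {} = 0"
      by (simp_all add: nested_rho_def rho_def Delta_kernel prime.Delta_kernel right.zero
          foldl_br.zero P.zero)
    then show "(-1) powi decalage n d *s ?G {} = 0" by simp
  qed
  also have "\<dots> = (-1) powi decalage n d *s (\<Sum>S\<in>Pow {..<n}. ?G S)"
    by (rule scale_sum_right[symmetric])
  also have "(\<Sum>S\<in>Pow {..<n}. ?G S) = 0"
    using suspendedD[OF x] by (intro nested_rho_sum) auto
  finally show ?thesis by simp
qed

lemma (in vector_space) jacobi_sum_add: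
  "jacobi_sum scale n d (\<lambda>\<sigma> i j. F \<sigma> i j + G \<sigma> i j) = jacobi_sum scale n d F + jacobi_sum scale n d G"
  by (simp add: jacobi_sum_def scale_right_distrib sum.distrib case_prod_unfold)

lemma (in V_data) L_infinity_algebra_derived_bracket:
  "L_infinity_algebra scale (suspended L \<aa>) (derived_bracket scale L br \<aa> P \<Delta>)"
proof unfold_locales
  fix n :: nat and x :: "nat \<Rightarrow> 'v" and d :: "nat \<Rightarrow> int"
  assume x: "\<And>p. p < n \<Longrightarrow> x p \<in> suspended L \<aa> (d p)"
  \<comment> \<open>\<open>\<Delta>\<close> is compatible with itself; the two halves of the
    compatibility sum then coincide, and \<open>2\<close> is invertible.\<close>
  interpret self: compatible_V_data scale L br \<aa> P \<Delta> \<Delta>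
    by unfold_locales (rule Delta_square)
  let ?l = "derived_bracket scale L br \<aa> P \<Delta>"
  let ?J = "jacobi_sum scale n d (nested ?l ?l n x)"
  have "2 *s ?J = ?J + ?J"
    by (metis one_add_one scale_left_distrib scale_one)
  also have "\<dots> = 0"
    using self.jacobi_sum_derived_bracket[OF x] by (simp only: jacobi_sum_add)
  finally show "?J = 0" by simp
qed (simp_all add: graded_suspended derived_bracket_multilinear derived_bracket_degree,
     rule derived_bracket_skew, simp_all)

theorem proposition4p10:
  fixes scale :: "'k::field_char_0 \<Rightarrow> 'v::ab_group_add \<Rightarrow> 'v"
    and L :: "int \<Rightarrow> 'v set"
    and br :: "'v \<Rightarrow> 'v \<Rightarrow> 'v"
    and \<aa> :: "'v set"
    and P :: "'v \<Rightarrow> 'v"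
    and \<Delta> \<Delta>' :: 'v
  assumes "compatible_V_data scale L br \<aa> P \<Delta> \<Delta>'"
  shows "compatible_L_infinity_algebra scale (suspended L \<aa>)
           (derived_bracket scale L br \<aa> P \<Delta>)
           (derived_bracket scale L br \<aa> P \<Delta>')"
proof -
  interpret compatible_V_data scale L br \<aa> P \<Delta> \<Delta>' by fact
  show ?thesis
    by (intro compatible_L_infinity_algebra.intro compatible_L_infinity_algebra_axioms.intro
        L_infinity_algebra_derived_bracket prime.L_infinity_algebra_derived_bracket
        jacobi_sum_derived_bracket)
qed

end
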